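(* Consider the discrete-time data-center model with three levels of data locality described in the context, operated under the JSQ-MW algorithm. For every arrival rate vector $\boldsymbol\lambda\in\Lambda$, the Markov chain $\{Z(t)=(\mathbf Q(t),\mathbf f(t)),t\ge0\}$ is positive recurrent (the system is stable). That is, JSQ-MW is throughput optimal and $\Lambda$ is the capacity region of the system.
   Context: Model. Time is slotted, $t=0,1,2,\dots$. There are $M$ servers $\mathcal M=\{1,\dots,M\}$ partitioned into racks; $K(m)$ is the rack of server $m$. A task type $\bar L$ is a $3$-element subset of $\mathcal M$ (servers storing the task's data); $\mathcal L$ is the set of types. For type $\bar L$: servers in $\bar L$ are local, $\bar L_k=\{m\notin\bar L:\exists n\in\bar L,K(m)=K(n)\}$ are rack-local, $\bar L_r=\mathcal M\setminus(\bar L\cup\bar L_k)$ are remote. At the beginning of slot $t$, $A_{\bar L}(t)$ tasks of type $\bar L$ arrive; arrival processes are independent across types and i.i.d. over time with $\mathbb E[A_{\bar L}(t)]=\lambda_{\bar L}$, and the total number of arrivals per slot is bounded. Service times are geometric with mean $1/\alpha$, $1/\beta$, $1/\gamma$ for local, rack-local, remote service respectively, with $1\ge\alpha>\beta>\gamma>0$; a server processes at most one task at a time, non-preemptively; a task departs at the end of the slot its service completes. Capacity region: $\Lambda$ is the set of $\boldsymbol\lambda=(\lambda_{\bar L})_{\bar L\in\mathcal L}$ for which there exist $\lambda_{\bar L,m}\ge0$ with $\lambda_{\bar L}=\sum_m\lambda_{\bar L,m}$ for all $\bar L$ and $\sum_{\bar L:m\in\bar L}\lambda_{\bar L,m}/\alpha+\sum_{\bar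 L:m\in\bar L_k}\lambda_{\bar L,m}/\beta+\sum_{\bar L:m\in\bar L_r}\lambda_{\bar L,m}/\gamma<1$ for all $m$. JSQ-MW algorithm. There is one queue per server; queue $m$ (length $Q_m(t)$) holds tasks local to server $m$. Routing: an arriving task of type $\bar L$ joins the shortest queue among $\{Q_m:m\in\bar L\}$ (ties broken uniformly at random). Scheduling: an idle server $m$ at slot $t$ is assigned a task from a queue $n=\eta_m(t)$ in $\arg\max_{n\in\mathcal M}\{\alpha Q_n(t)I_{\{n=m\}},\ \beta Q_n(t)I_{\{K(n)=K(m)\}},\ \gamma Q_n(t)I_{\{K(n)\ne K(m)\}}\}$ (ties at random). Server $m$ serving a task from queue $n$ completes it in a slot with probability $\alpha$ if $n=m$, $\beta$ if $n\ne m$ and $K(n)=K(m)$, and $\gamma$ if $K(n)\ne K(m)$. The working status $f_m(t)$ is $-1$ if server $m$ is idle and $n$ if it is processing a task from queue $n$; $\mathbf Q=(Q_1,\dots,Q_M)$, $\mathbf f=(f_1,\dots,f_M)$. Stability means positive recurrence of $Z(t)$; an algorithm is throughput optimal if it stabilizes the system for every $\boldsymbol\lambda\in\Lambda$. *)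

theory Defs
  imports "HOL-Probability.Probability"
begin

text \<open>Servers are 0..<M (instead of 1..M); racks are given by K; a task type is a
3-element set of servers. The state Z = (Q, f) with Q m the queue length of queue m
and f m = -1 (idle) or n (serving a task from queue n).\<close>

type_synonym state = "(nat \<Rightarrow> nat) \<times> (nat \<Rightarrow> int)"

primrec seq_pmf :: "('b \<Rightarrow> 'a \<Rightarrow> 'a pmf) \<Rightarrow> 'b list \<Rightarrow> 'a \<Rightarrow> 'a pmf" where
  "seq_pmf g [] x = return_pmf x"
| "seq_pmf g (b # bs) x = bind_pmf (g b x) (seq_pmf g bs)"

text \<open>Per-slot completion probability when server m serves a task from queue n
(queue n holds tasks local to server n).\<close>
definition rate :: "(nat \<Rightarrow> nat) \<Rightarrow> real \<Rightarrow> real \<Rightarrow> real \<Rightarrow> nat \<Rightarrow> nat \<Rightarrow> real" where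
  "rate K \<alpha> \<beta> \<gamma> m n = (if n = m then \<alpha> else if K n = K m then \<beta> else \<gamma>)"

definition type_rate :: "(nat \<Rightarrow> nat) \<Rightarrow> real \<Rightarrow> real \<Rightarrow> real \<Rightarrow> nat set \<Rightarrow> nat \<Rightarrow> real" where
  "type_rate K \<alpha> \<beta> \<gamma> L m =
     (if m \<in> L then \<alpha> else if (\<exists>n\<in>L. K m = K n) then \<beta> else \<gamma>)"

definition capacity_region ::
  "nat \<Rightarrow> (nat \<Rightarrow> nat) \<Rightarrow> nat set list \<Rightarrow> real \<Rightarrow> real \<Rightarrow> real \<Rightarrow> (nat set \<Rightarrow> real) set" where
  "capacity_region M K Ls \<alpha> \<beta> \<gamma> =
     {lam. \<exists>l :: nat set \<Rightarrow> nat \<Rightarrow> real.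
        (\<forall>L m. 0 \<le> l L m) \<and>
        (\<forall>L\<in>set Ls. lam L = (\<Sum>m<M. l L m)) \<and>
        (\<forall>m<M. (\<Sum>L\<in>set Ls. l L m / type_rate K \<alpha> \<beta> \<gamma> L m) < 1)}"

definition route1 :: "nat set \<Rightarrow> (nat \<Rightarrow> nat) \<Rightarrow> (nat \<Rightarrow> nat) pmf" where
  "route1 L Q = map_pmf (\<lambda>n. Q(n := Q n + 1)) (pmf_of_set {n \<in> L. \<forall>n'\<in>L. Q n \<le> Q n'})"

definition arrive_type :: "(nat set \<Rightarrow> nat pmf) \<Rightarrow> nat set \<Rightarrow> (nat \<Rightarrow> nat) \<Rightarrow> (nat \<Rightarrow> nat) pmf" where
  "arrive_type arr L Q = bind_pmf (arr L) (\<lambda>a. seq_pmf route1 (replicate a L) Q)"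

text \<open>MaxWeight scheduling of server m if idle (uniform tie breaking); if all weights
are zero (all queues empty) the server stays idle.\<close>
definition sched1 :: "nat \<Rightarrow> (nat \<Rightarrow> nat) \<Rightarrow> real \<Rightarrow> real \<Rightarrow> real \<Rightarrow> nat \<Rightarrow> state \<Rightarrow> state pmf" where
  "sched1 M K \<alpha> \<beta> \<gamma> m z =
     (let Q = fst z; f = snd z in
      if f m \<noteq> -1 then return_pmf z else
      let W = Max ((\<lambda>n. rate K \<alpha> \<beta> \<gamma> m n * real (Q n)) ` {..<M}) in
      if W = 0 then return_pmf z else
      map_pmf (\<lambda>n. (Q(n := Q n - 1), f(m := int n)))
        (pmf_of_set {n \<in> {..<M}. rate K \<alpha> \<beta> \<gamma> m n * real (Q n) = W}))"

definition serve1 :: "(nat \<Rightarrow> nat) \<Rightarrow> real \<Rightarrow> real \<Rightarrow> real \<Rightarrow> nat \<Rightarrow> (nat \<Rightarrow> int) \<Rightarrow> (nat \<Rightarrow> int) pmf" where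
  "serve1 K \<alpha> \<beta> \<gamma> m f =
     (if f m = -1 then return_pmf f else
      map_pmf (\<lambda>c. if c then f(m := -1) else f)
        (bernoulli_pmf (rate K \<alpha> \<beta> \<gamma> m (nat (f m)))))"

definition jsq_mw_step ::
  "nat \<Rightarrow> (nat \<Rightarrow> nat) \<Rightarrow> nat set list \<Rightarrow> (nat set \<Rightarrow> nat pmf) \<Rightarrow> real \<Rightarrow> real \<Rightarrow> real \<Rightarrow> state \<Rightarrow> state pmf" where
  "jsq_mw_step M K Ls arr \<alpha> \<beta> \<gamma> z =
     bind_pmf (seq_pmf (arrive_type arr) Ls (fst z)) (\<lambda>Q1.
     bind_pmf (seq_pmf (sched1 M K \<alpha> \<beta> \<gamma>) [0..<M] (Q1, snd z)) (\<lambda>z2.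
     bind_pmf (seq_pmf (serve1 K \<alpha> \<beta> \<gamma>) [0..<M] (snd z2)) (\<lambda>f3.
     return_pmf (fst z2, f3))))"

definition valid_state :: "nat \<Rightarrow> state \<Rightarrow> bool" where
  "valid_state M z \<longleftrightarrow>
     (\<forall>m. M \<le> m \<longrightarrow> fst z m = 0 \<and> snd z m = -1) \<and>
     (\<forall>m<M. snd z m = -1 \<or> (\<exists>n<M. snd z m = int n))"

text \<open>first_hit K S n x: probability that the chain with kernel K started at x
enters S for the first time (at a time \<ge> 1) exactly at time n.\<close>
fun first_hit :: "('a \<Rightarrow> 'a pmf) \<Rightarrow> 'a set \<Rightarrow> nat \<Rightarrow> 'a \<Rightarrow> real" where
  "first_hit K S 0 x = 0"
| "first_hit K S (Suc 0) x = measure_pmf.prob (K x) S"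
| "first_hit K S (Suc (Suc n)) x =
     measure_pmf.expectation (K x) (\<lambda>y. if y \<in> S then 0 else first_hit K S (Suc n) y)"

definition pos_recurrent_state :: "('a \<Rightarrow> 'a pmf) \<Rightarrow> 'a \<Rightarrow> bool" where
  "pos_recurrent_state K s \<longleftrightarrow>
     (\<lambda>n. first_hit K {s} n s) sums 1 \<and> summable (\<lambda>n. real n * first_hit K {s} n s)"

text \<open>The chain on state space V is positive recurrent (stable): from every state it
is almost surely absorbed into the (closed) set of positive recurrent states.\<close>
definition positive_recurrent_chain :: "('a \<Rightarrow> 'a pmf) \<Rightarrow> 'a set \<Rightarrow> bool" where
  "positive_recurrent_chain K V \<longleftrightarrow>
     (\<forall>x\<in>V. pos_recurrent_state K x \<or>
        (\<lambda>n. first_hit K {s. pos_recurrent_state K s} n x) sums 1)"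

end

theory Submission
  imports Defs
begin

text \<open>Count tasks in service with the queue they came from, \<open>X n = Q n + occ f n\<close>, so that scheduling
preserves \<open>X\<close>. The drift of \<open>(\<Sum>n. X n\<^sup>2) / 2\<close> over one slot is, up to a constant,
\<open>\<Sum>L. \<lambda> L * min Q on L\<close> (join the shortest queue) minus \<open>\<Sum>m. r m (f m) * Q (f m)\<close>. Since service is
non-preemptive, the last sum may fall short of the MaxWeight value \<open>\<Sum>m. weight m Q\<close>, where
\<open>weight m Q = max n. r m n * Q n\<close>; the shortfall of a busy server is its \<open>gap\<close>. As a server
becomes idle with probability at least \<open>\<gamma>\<close> in every slot and \<open>gap\<close> otherwise changes by a bounded
amount, adding \<open>gap / \<gamma>\<close> to the potential gains an extra drift \<open>- gap\<close> and restores the MaxWeight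
value with a one-step drift argument. The strict inequality in the capacity region then makes
the drift at most \<open>c - \<epsilon> * \<alpha> * (\<Sum>n. Q n)\<close>.

The chain need not be irreducible. From every state of the finite exceptional set one reaches a
state \<open>y\<close> that is reachable again from everything in that set that \<open>y\<close> reaches; such a \<open>y\<close> has a
finite mean return time, and the chain hits the set of these states almost surely.\<close>

section \<open>Hitting times and the Foster--Lyapunov criterion\<close>

text \<open>The iterated kernel killed on entering \<open>D\<close>; the starting point itself is not tested against \<open>D\<close>.\<close>

primrec taboo :: "('a \<Rightarrow> 'a pmf) \<Rightarrow> 'a set \<Rightarrow> nat \<Rightarrow> ('a \<Rightarrow> ennreal) \<Rightarrow> 'a \<Rightarrow> ennreal" where
  "taboo K D 0 f x = f x"
| "taboo K D (Suc n) f x = (\<integral>\<^sup>+y. (if y \<in> D then 0 else taboo K D n f y) \<partial>measure_pmf (K x))"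

abbreviation survive :: "('a \<Rightarrow> 'a pmf) \<Rightarrow> 'a set \<Rightarrow> nat \<Rightarrow> 'a \<Rightarrow> ennreal" where
  "survive K D n \<equiv> taboo K D n (\<lambda>_. 1)"

text \<open>\<open>survive K D k x\<close> is P(T > k) for the first time T \<ge> 1 at which
  \<open>D\<close> is entered, so this tail sum is the mean of min(T, n).\<close>

definition trunc_hit_time :: "('a \<Rightarrow> 'a pmf) \<Rightarrow> 'a set \<Rightarrow> nat \<Rightarrow> 'a \<Rightarrow> ennreal" where
  "trunc_hit_time K D n x = (\<Sum>k<n. survive K D k x)"

definition closed_under :: "('a \<Rightarrow> 'a pmf) \<Rightarrow> 'a set \<Rightarrow> bool" where
  "closed_under K S \<longleftrightarrow> (\<forall>x\<in>S. set_pmf (K x) \<subseteq> S)"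

abbreviation step_rel :: "('a \<Rightarrow> 'a pmf) \<Rightarrow> 'a rel" where
  "step_rel K \<equiv> {(x, y). y \<in> set_pmf (K x)}"

section \<open>Monotonicity, linearity and the Markov property of the killed kernel\<close>

lemma nn_integral_pmf_mono:
  assumes "\<And>y. y \<in> set_pmf p \<Longrightarrow> f y \<le> g y"
  shows "(\<integral>\<^sup>+y. f y \<partial>measure_pmf p) \<le> (\<integral>\<^sup>+y. g y \<partial>measure_pmf p)"
  by (rule nn_integral_mono_AE) (simp add: AE_measure_pmf_iff assms)

lemma taboo_mono:
  assumes "closed_under K S" "\<And>x. x \<in> S \<Longrightarrow> f x \<le> g x" "x \<in> S"
  shows "taboo K D n f x \<le> taboo K D n g x"
  using \<open>x \<in> S\<close>
proof (induction n arbitrary: x)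
  case (Suc n)
  then show ?case
    using assms(1) unfolding taboo.simps closed_under_def
    by (intro nn_integral_pmf_mono) (simp add: subset_iff split: if_split)
qed (simp add: assms)

lemma taboo_linear:
  "taboo K D n (\<lambda>y. f y + c * g y) x = taboo K D n f x + c * taboo K D n g x"
proof (induction n arbitrary: x)
  case (Suc n)
  have "taboo K D (Suc n) (\<lambda>y. f y + c * g y) x =
     (\<integral>\<^sup>+y. (if y \<in> D then 0 else taboo K D n f y) + c * (if y \<in> D then 0 else taboo K D n g y) \<partial>measure_pmf (K x))"
    by (auto simp: Suc intro!: nn_integral_cong)
  also have "\<dots> = taboo K D (Suc n) f x + c * taboo K D (Suc n) g x"
    by (simp add: nn_integral_add nn_integral_cmult)
  finally show ?case .
qed simp

lemma taboo_taboo: "taboo K D n (taboo K D k f) x = taboo K D (n + k) f x"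
  by (induction n arbitrary: x) (simp_all cong: if_cong)

lemma survive_le_1: "survive K D n x \<le> 1"
proof (induction n arbitrary: x)
  case (Suc n)
  have "survive K D (Suc n) x \<le> (\<integral>\<^sup>+y. 1 \<partial>measure_pmf (K x))"
    unfolding taboo.simps by (rule nn_integral_pmf_mono) (simp add: Suc)
  then show ?case by simp
qed simp

lemma survive_Suc_le: "survive K D (Suc n) x \<le> survive K D n x"
proof (induction n arbitrary: x)
  case 0
  show ?case using survive_le_1[of K D "Suc 0" x] by simp
next
  case (Suc n)
  show ?case
    unfolding taboo.simps(2)[of _ _ "Suc n"] taboo.simps(2)[of _ _ "n"]
    by (rule nn_integral_pmf_mono) (use Suc in auto)
qed

lemma survive_antimono: "n \<le> k \<Longrightarrow> survive K D k x \<le> survive K D n x"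
  by (rule lift_Suc_antimono_le[of "\<lambda>n. survive K D n x"]) (rule survive_Suc_le)

text \<open>Markov property at time \<open>N\<close>: what remains after \<open>N\<close> steps is a
  fresh truncated time from the state reached, counted only on paths that have avoided
  \<open>D\<close>.\<close>

lemma trunc_hit_time_add:
  "trunc_hit_time K D (N + n) x = trunc_hit_time K D N x + taboo K D N (trunc_hit_time K D n) x"
proof (induction n)
  case 0
  have "taboo K D N (\<lambda>_. 0) x = 0" by (induction N arbitrary: x) (simp_all cong: if_cong)
  then show ?case by (simp add: trunc_hit_time_def)
next
  case (Suc n)
  have "trunc_hit_time K D (Suc n) = (\<lambda>y. trunc_hit_time K D n y + 1 * survive K D n y)"
    by (auto simp: trunc_hit_time_def)
  then have "taboo K D N (trunc_hit_time K D (Suc n)) x =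
     taboo K D N (trunc_hit_time K D n) x + survive K D (N + n) x"
    using taboo_linear[of K D N "trunc_hit_time K D n" 1 "survive K D n" x] by (simp add: taboo_taboo)
  moreover have "trunc_hit_time K D (N + Suc n) x = trunc_hit_time K D (N + n) x + survive K D (N + n) x"
    by (simp add: trunc_hit_time_def)
  ultimately show ?case by (simp add: Suc.IH add.assoc)
qed

lemma trunc_hit_time_Suc:
  "trunc_hit_time K D (Suc n) x =
     1 + (\<integral>\<^sup>+y. (if y \<in> D then 0 else trunc_hit_time K D n y) \<partial>measure_pmf (K x))"
  using trunc_hit_time_add[of K D 1 n x] by (simp add: trunc_hit_time_def cong: if_cong)

lemma trunc_hit_time_mono: "n \<le> k \<Longrightarrow> trunc_hit_time K D n x \<le> trunc_hit_time K D k x"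
  unfolding trunc_hit_time_def by (rule sum_mono2) auto

lemma trunc_hit_time_le: "trunc_hit_time K D n x \<le> of_nat n"
  using sum_mono[of "{..<n}" "\<lambda>k. survive K D k x" "\<lambda>_. 1"] survive_le_1[of K D _ x]
  by (simp add: trunc_hit_time_def)

section \<open>Uniform bounds on mean hitting times\<close>

lemma survive_less_1_if_reachable:
  assumes "(x, d) \<in> (step_rel K)\<^sup>+" "d \<in> D"
  shows "\<exists>n. survive K D n x < 1"
proof -
  \<comment> \<open>An average of values at most 1 is strictly below 1 once some point of the
    support has a value below 1. This is applied backwards along a path to \<open>d\<close>.\<close>
  have *: "(\<integral>\<^sup>+y. f y \<partial>measure_pmf p) < 1"
    if "\<And>y. f y \<le> 1" "y \<in> set_pmf p" "f y < 1" for f :: "'a \<Rightarrow> ennreal" and p y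
  proof (rule ccontr)
    assume "\<not> ?thesis"
    moreover have le: "(\<integral>\<^sup>+y. f y \<partial>measure_pmf p) \<le> 1"
      using nn_integral_pmf_mono[of p f "\<lambda>_. 1"] that(1) by simp
    ultimately have eq: "(\<integral>\<^sup>+y. f y \<partial>measure_pmf p) = 1" by simp
    have "(\<integral>\<^sup>+y. 1 - f y \<partial>measure_pmf p) = (\<integral>\<^sup>+y. 1 \<partial>measure_pmf p) - (\<integral>\<^sup>+y. f y \<partial>measure_pmf p)"
      by (rule nn_integral_diff) (use eq that in auto)
    then have "(\<integral>\<^sup>+y. 1 - f y \<partial>measure_pmf p) = 0" using eq by simp
    then have "1 - f y = 0"
      using that(2) by (subst (asm) nn_integral_0_iff_AE) (auto simp: AE_measure_pmf_iff)
    with that(3) show False by (simp add: diff_eq_0_iff_ennreal)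
  qed
  from assms(1) show ?thesis
  proof (induction rule: converse_trancl_induct)
    case (base y)
    have "survive K D (Suc 0) y < 1"
      unfolding taboo.simps(2) by (rule *[of _ d]) (use base assms(2) in auto)
    then show ?case by blast
  next
    case (step y z)
    then obtain n where n: "survive K D n z < 1" by blast
    have "survive K D (Suc n) y < 1"
      unfolding taboo.simps(2) by (rule *[of _ z]) (use step n survive_le_1[of K D n] in auto)
    then show ?case by blast
  qed
qed

text \<open>The inequality can be solved for \<open>m\<close> because \<open>m\<close> is finite.
  This is why hitting times are truncated first and then bounded uniformly in
  \<open>n\<close>.\<close>

lemma ennreal_le_of_contraction:
  fixes m B s :: ennreal
  assumes "m \<le> B + s * m" "s < 1" "m < \<infinity>" "B < \<infinity>"
  shows "m \<le> B / (1 - s)"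
proof -
  obtain m' B' s' where r: "m = ennreal m'" "B = ennreal B'" "s = ennreal s'" "0 \<le> m'" "0 \<le> B'" "0 \<le> s'"
    using assms by (metis ennreal_cases infinity_ennreal_def less_irrefl less_trans ennreal_one_less_top)
  have s: "s' < 1" using assms(2) r by (simp add: ennreal_less_iff flip: ennreal_1)
  have "ennreal m' \<le> ennreal (B' + s' * m')"
    using assms(1) r by (simp add: ennreal_mult ennreal_plus)
  then have "m' \<le> B' + s' * m'" using r by (subst (asm) ennreal_le_iff) auto
  then have "m' \<le> B' / (1 - s')" using s by (simp add: field_simps)
  moreover have "B / (1 - s) = ennreal (B' / (1 - s'))"
    using r s by (simp add: divide_ennreal ennreal_minus flip: ennreal_1)
  ultimately show ?thesis using r(1) by (simp add: ennreal_leI)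
qed

text \<open>A restart argument: \<open>W\<close> bounds the mean time to return to \<open>C\<close>,
  and from every state of the finite set \<open>C\<close> the target \<open>D\<close> is hit within
  a common number of steps with probability bounded below.\<close>

lemma bounded_hit_time:
  fixes W :: "'a \<Rightarrow> ennreal"
  assumes closed: "closed_under K S" and fin: "finite C" and CS: "C \<subseteq> S"
    and W_fin: "\<And>x. x \<in> S \<Longrightarrow> W x < \<infinity>"
    and W: "\<And>x. x \<in> S \<Longrightarrow> 1 + (\<integral>\<^sup>+y. (if y \<in> C then 0 else W y) \<partial>measure_pmf (K x)) \<le> W x"
    and reach: "\<And>x. x \<in> C \<Longrightarrow> \<exists>d\<in>D. (x, d) \<in> (step_rel K)\<^sup>+"
  shows "\<exists>b<\<infinity>. \<forall>x\<in>S. \<forall>n. trunc_hit_time K D n x \<le> W x + b"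
proof -
  define m where "m n = (SUP z\<in>C. trunc_hit_time K D n z)" for n
  define b0 where "b0 = (SUP z\<in>C. W z)"
  have m_upper: "trunc_hit_time K D n z \<le> m n" if "z \<in> C" for z n
    unfolding m_def using that by (rule SUP_upper)
  have m_mono: "m n \<le> m k" if "n \<le> k" for n k
    unfolding m_def using that by (intro SUP_mono) (auto intro: trunc_hit_time_mono)
  have m_fin: "m n < \<infinity>" for n
  proof -
    have "m n \<le> of_nat n" unfolding m_def by (rule SUP_least) (rule trunc_hit_time_le)
    then show ?thesis by (rule le_less_trans) (simp add: of_nat_less_top)
  qed
  have b0_upper: "W z \<le> b0" if "z \<in> C" for z
    unfolding b0_def using that by (rule SUP_upper)
  have b0_fin: "b0 < \<infinity>"
    unfolding b0_def using fin CS W_fin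
    by (cases "C = {}") (auto simp: finite_Sup_less_iff bot_ennreal)
  \<comment> \<open>Before \<open>D\<close> is hit, the chain first spends at most \<open>W x\<close> steps on average outside \<open>C\<close>.\<close>
  have excursion: "trunc_hit_time K D n x \<le> W x + m n" if "x \<in> S" for n x
    using that
  proof (induction n arbitrary: x)
    case 0
    then show ?case by (simp add: trunc_hit_time_def)
  next
    case (Suc n)
    have "(\<integral>\<^sup>+y. (if y \<in> D then 0 else trunc_hit_time K D n y) \<partial>measure_pmf (K x))
       \<le> (\<integral>\<^sup>+y. (if y \<in> C then 0 else W y) + m n \<partial>measure_pmf (K x))"
    proof (rule nn_integral_pmf_mono)
      fix y assume "y \<in> set_pmf (K x)"
      then have "y \<in> S" using closed Suc.prems by (auto simp: closed_under_def)
      then show "(if y \<in> D then 0 else trunc_hit_time K D n y) \<le> (if y \<in> C then 0 else W y) + m n"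
        using Suc.IH m_upper by auto
    qed
    also have "\<dots> = (\<integral>\<^sup>+y. (if y \<in> C then 0 else W y) \<partial>measure_pmf (K x)) + m n"
      by (simp add: nn_integral_add)
    finally have "trunc_hit_time K D (Suc n) x
       \<le> (1 + (\<integral>\<^sup>+y. (if y \<in> C then 0 else W y) \<partial>measure_pmf (K x))) + m n"
      unfolding trunc_hit_time_Suc by (simp add: add.assoc add_left_mono)
    also have "\<dots> \<le> W x + m (Suc n)"
      using W[OF Suc.prems] m_mono[of n "Suc n"] by (intro add_mono) auto
    finally show ?case .
  qed
  \<comment> \<open>The drift of \<open>W\<close> is uncontrolled only on entering \<open>C\<close>,
    where \<open>W\<close> is at most \<open>b0\<close>; hence each step adds at most
    \<open>b0\<close> to its mean.\<close>
  have taboo_W: "taboo K D n W x \<le> W x + of_nat n * b0" if "x \<in> S" for n x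
    using that
  proof (induction n arbitrary: x)
    case (Suc n)
    have "taboo K D (Suc n) W x \<le> (\<integral>\<^sup>+y. (if y \<in> C then 0 else W y) + (b0 + of_nat n * b0) \<partial>measure_pmf (K x))"
      unfolding taboo.simps
    proof (rule nn_integral_pmf_mono)
      fix y assume "y \<in> set_pmf (K x)"
      then have "y \<in> S" using closed Suc.prems by (auto simp: closed_under_def)
      then have IH: "taboo K D n W y \<le> W y + of_nat n * b0" by (rule Suc.IH)
      have "W y \<le> (if y \<in> C then 0 else W y) + b0" using b0_upper by auto
      from order_trans[OF IH add_right_mono[OF this]] have "taboo K D n W y \<le> (if y \<in> C then 0 else W y) + (b0 + of_nat n * b0)"
        by (simp only: add.assoc)
      then show "(if y \<in> D then 0 else taboo K D n W y) \<le> (if y \<in> C then 0 else W y) + (b0 + of_nat n * b0)"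
        by auto
    qed
    also have "\<dots> = (\<integral>\<^sup>+y. (if y \<in> C then 0 else W y) \<partial>measure_pmf (K x)) + (b0 + of_nat n * b0)"
      by (simp add: nn_integral_add)
    also have "\<dots> \<le> W x + (b0 + of_nat n * b0)"
      by (intro add_right_mono order_trans[OF _ W[OF Suc.prems]]) (rule add_increasing, simp_all)
    finally show ?case by (simp add: algebra_simps)
  qed simp
  have "\<forall>x\<in>C. \<exists>n. survive K D n x < 1"
  proof
    fix x assume "x \<in> C"
    from reach[OF this] obtain d where "d \<in> D" "(x, d) \<in> (step_rel K)\<^sup>+" ..
    then show "\<exists>n. survive K D n x < 1" by (intro survive_less_1_if_reachable)
  qed
  from bchoice[OF this] obtain t where t: "\<And>x. x \<in> C \<Longrightarrow> survive K D (t x) x < 1" by auto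
  define N where "N = (\<Sum>x\<in>C. t x)"
  have N: "survive K D N x < 1" if "x \<in> C" for x
    using survive_antimono[of "t x" N K D x] t[OF that] member_le_sum[of x C t] fin that
    by (auto simp: N_def intro: le_less_trans)
  define s where "s = (SUP x\<in>C. survive K D N x)"
  have s: "s < 1"
    unfolding s_def using fin N
    by (cases "C = {}") (auto simp: finite_Sup_less_iff bot_ennreal)
  define B where "B = of_nat N + (b0 + of_nat N * b0)"
  have B_fin: "B < \<infinity>" using b0_fin by (simp add: B_def ennreal_mult_less_top of_nat_less_top)
  \<comment> \<open>From \<open>C\<close>, the chain survives \<open>N\<close> steps with probability at most \<open>s < 1\<close>.\<close>
  have contraction: "m n \<le> B + s * m n" for n
    unfolding m_def[of n]
  proof (rule SUP_least)
    fix x assume x: "x \<in> C"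
    then have xS: "x \<in> S" using CS by auto
    \<comment> \<open>The chain restarts at time \<open>N\<close>: the excursion bound applies to
      the state reached there, and only the surviving mass, at most \<open>s\<close>, carries the
      term \<open>m n\<close>.\<close>
    have "taboo K D N (trunc_hit_time K D n) x \<le> taboo K D N (\<lambda>y. W y + m n * 1) x"
      by (rule taboo_mono[OF closed]) (use excursion xS in auto)
    also have "\<dots> = taboo K D N W x + m n * survive K D N x" by (rule taboo_linear)
    also have "\<dots> \<le> (b0 + of_nat N * b0) + m n * s"
    proof (rule add_mono)
      show "taboo K D N W x \<le> b0 + of_nat N * b0"
        by (rule order_trans[OF taboo_W[OF xS] add_right_mono[OF b0_upper[OF x]]])
      show "m n * survive K D N x \<le> m n * s"
        unfolding s_def using x by (intro mult_left_mono SUP_upper) auto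
    qed
    finally have "trunc_hit_time K D (N + n) x \<le> of_nat N + ((b0 + of_nat N * b0) + m n * s)"
      unfolding trunc_hit_time_add by (rule add_mono[OF trunc_hit_time_le])
    then have "trunc_hit_time K D n x \<le> B + s * m n"
      using trunc_hit_time_mono[of n "N + n" K D x] by (simp add: B_def ac_simps)
    then show "trunc_hit_time K D n x \<le> B + s * (SUP z\<in>C. trunc_hit_time K D n z)"
      by (simp add: m_def)
  qed
  have m_bound: "m n \<le> B / (1 - s)" for n
    by (rule ennreal_le_of_contraction[OF contraction s m_fin B_fin])
  have "\<forall>x\<in>S. \<forall>n. trunc_hit_time K D n x \<le> W x + B / (1 - s)"
    by (intro ballI allI order_trans[OF excursion add_left_mono[OF m_bound]])
  moreover have "B / (1 - s) < \<infinity>"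
    using B_fin s by (auto simp: ennreal_divide_eq_top_iff less_top[symmetric] diff_eq_0_iff_ennreal)
  ultimately show ?thesis by blast
qed

section \<open>First-hit probabilities as differences of survival probabilities\<close>

lemma first_hit_bounds: "0 \<le> first_hit K D n x \<and> first_hit K D n x \<le> 1"
proof (induction K D n x rule: first_hit.induct)
  case (3 K S n x)
  have "integrable (measure_pmf (K x)) (\<lambda>y. if y \<in> S then 0 else first_hit K S (Suc n) y)"
    by (rule measure_pmf.integrable_const_bound[where B = 1]) (use 3 in auto)
  then have "measure_pmf.expectation (K x) (\<lambda>y. if y \<in> S then 0 else first_hit K S (Suc n) y)
     \<le> measure_pmf.expectation (K x) (\<lambda>_. 1)"
    by (rule integral_mono) (use 3 in auto)
  then show ?case
    using 3 by (auto intro!: integral_nonneg_AE)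
qed auto

text \<open>Paths that avoid \<open>D\<close> for \<open>n\<close> steps are split by whether the
  next step enters \<open>D\<close>. This links the real-valued \<open>first_hit\<close> to the
  killed kernel.\<close>

lemma first_hit_survive:
  "ennreal (first_hit K D (Suc n) x) + survive K D (Suc n) x = survive K D n x"
proof (induction n arbitrary: x)
  case 0
  have "survive K D (Suc 0) x = (\<integral>\<^sup>+y. indicator (- D) y \<partial>measure_pmf (K x))"
    by (auto intro!: nn_integral_cong simp: indicator_def)
  also have "\<dots> = ennreal (measure_pmf.prob (K x) (- D))"
    by (simp add: measure_pmf.emeasure_eq_measure)
  finally have "ennreal (first_hit K D (Suc 0) x) + survive K D (Suc 0) x =
      ennreal (measure_pmf.prob (K x) D + measure_pmf.prob (K x) (- D))"
    by (simp add: ennreal_plus)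
  also have "measure_pmf.prob (K x) D + measure_pmf.prob (K x) (- D) = 1"
    using measure_pmf.prob_compl[of D "K x"] by (simp add: Compl_eq_Diff_UNIV)
  finally show ?case by simp
next
  case (Suc n)
  have int: "integrable (measure_pmf (K x)) (\<lambda>y. if y \<in> D then 0 else first_hit K D (Suc n) y)"
    by (rule measure_pmf.integrable_const_bound[where B = 1])
       (use first_hit_bounds[of K D "Suc n"] in auto)
  have "ennreal (first_hit K D (Suc (Suc n)) x) =
      (\<integral>\<^sup>+y. ennreal (if y \<in> D then 0 else first_hit K D (Suc n) y) \<partial>measure_pmf (K x))"
    unfolding first_hit.simps
    by (rule nn_integral_eq_integral[symmetric, OF int]) (use first_hit_bounds[of K D "Suc n"] in auto)
  then have "ennreal (first_hit K D (Suc (Suc n)) x) + survive K D (Suc (Suc n)) x =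
     (\<integral>\<^sup>+y. ennreal (if y \<in> D then 0 else first_hit K D (Suc n) y)
        + (if y \<in> D then 0 else survive K D (Suc n) y) \<partial>measure_pmf (K x))"
    unfolding taboo.simps(2)[of _ _ "Suc n"] by (simp only:) (rule nn_integral_add[symmetric]; simp)
  also have "\<dots> = survive K D (Suc n) x"
    unfolding taboo.simps(2)[of _ _ n] by (rule nn_integral_cong) (use Suc in auto)
  finally show ?case .
qed

text \<open>The survival probabilities have bounded partial sums, hence tend to 0. The first-hit
  probabilities therefore telescope to 1, and their first moment is controlled by the sum of the
  tails.\<close>

lemma finite_mean_hit_time:
  assumes "\<And>n. trunc_hit_time K D n x \<le> b" "b < \<infinity>"
  shows "(\<lambda>n. first_hit K D n x) sums 1" "summable (\<lambda>n. real n * first_hit K D n x)"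
proof -
  define s where "s n = enn2real (survive K D n x)" for n
  have s: "survive K D n x = ennreal (s n)" "0 \<le> s n" for n
    unfolding s_def using survive_le_1[of K D n x]
    by (auto intro!: ennreal_enn2real[symmetric] elim: le_less_trans)
  have sum_s: "(\<Sum>k<n. s k) \<le> enn2real b" for n
  proof -
    have "ennreal (\<Sum>k<n. s k) \<le> b"
      using assms(1)[of n] s by (simp add: trunc_hit_time_def sum_ennreal)
    then show ?thesis using assms(2) by (metis enn2real_mono enn2real_ennreal infinity_ennreal_def s(2) sum_nonneg)
  qed
  have "summable s"
    by (rule summableI_nonneg_bounded[OF s(2) sum_s])
  then have lim: "s \<longlonglongrightarrow> 0" by (rule summable_LIMSEQ_zero)
  have F: "first_hit K D (Suc n) x = s n - s (Suc n)" for n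
  proof -
    have "ennreal (first_hit K D (Suc n) x + s (Suc n)) = ennreal (s n)"
      using first_hit_survive[of K D n x, unfolded s(1)] s(2) first_hit_bounds[of K D "Suc n" x]
      by (simp add: ennreal_plus)
    then have "first_hit K D (Suc n) x + s (Suc n) = s n"
      by (subst (asm) ennreal_inj) (use s first_hit_bounds[of K D "Suc n" x] in auto)
    then show ?thesis by simp
  qed
  have "s 0 = 1" by (simp add: s_def)
  then have "(\<lambda>n. first_hit K D (Suc n) x) sums 1"
    using telescope_sums'[OF lim] F by simp
  then show "(\<lambda>n. first_hit K D n x) sums 1" by (subst (asm) sums_Suc_iff) simp
  have "summable (\<lambda>n. real (Suc n) * first_hit K D (Suc n) x)"
  proof (rule summableI_nonneg_bounded)
    show "0 \<le> real (Suc n) * first_hit K D (Suc n) x" for n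
      using first_hit_bounds[of K D "Suc n" x] by simp
    have "(\<Sum>k<n. real (Suc k) * first_hit K D (Suc k) x) = (\<Sum>k<n. s k) - real n * s n" for n
      unfolding F by (induction n) (auto simp: algebra_simps)
    then show "(\<Sum>k<n. real (Suc k) * first_hit K D (Suc k) x) \<le> enn2real b" for n
      using sum_s[of n] s(2)[of n] by (simp add: add_increasing2 diff_le_eq)
  qed
  then show "summable (\<lambda>n. real n * first_hit K D n x)" by (subst (asm) summable_Suc_iff)
qed

section \<open>Communicating states and positive recurrence\<close>

lemma reachable_closed: "closed_under K {y. (x, y) \<in> (step_rel K)\<^sup>*}"
  by (auto simp: closed_under_def intro: rtrancl_into_rtrancl)

lemma closed_under_reachable:
  assumes "closed_under K S" "x \<in> S" "(x, y) \<in> (step_rel K)\<^sup>*"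
  shows "y \<in> S"
  using assms(3) by induction (use assms in \<open>auto simp: closed_under_def\<close>)

text \<open>The hitting time bound is used with three targets: the empty set, to see that
  \<open>C\<close> is always reachable; a single state, for its mean return time; all positive
  recurrent states, for absorption.\<close>

theorem positive_recurrent_of_finite_hit_time:
  fixes W :: "'a \<Rightarrow> ennreal"
  assumes closed: "closed_under K S" and fin: "finite C" and CS: "C \<subseteq> S"
    and W_fin: "\<And>x. x \<in> S \<Longrightarrow> W x < \<infinity>"
    and W: "\<And>x. x \<in> S \<Longrightarrow> 1 + (\<integral>\<^sup>+y. (if y \<in> C then 0 else W y) \<partial>measure_pmf (K x)) \<le> W x"
  shows "positive_recurrent_chain K S"
proof -
  define R where "R x = {y\<in>C. (x, y) \<in> (step_rel K)\<^sup>+}" for x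
  have R_fin: "finite (R x)" for x using fin by (simp add: R_def)
  have R_mono: "R y \<subseteq> R x" if "y \<in> R x" for x y
    using that by (auto simp: R_def intro: trancl_trans)
  \<comment> \<open>If no state of \<open>C\<close> were reachable, there would be a finite bound,
    uniform in \<open>n\<close>, on the truncated hitting time of the empty set, which is
    \<open>n\<close>.\<close>
  have R_ne: "R x \<noteq> {}" if x: "x \<in> S" for x
  proof
    assume emp: "R x = {}"
    define T where "T = {y. (x, y) \<in> (step_rel K)\<^sup>+}"
    have T: "closed_under K T" by (auto simp: T_def closed_under_def intro: trancl_into_trancl)
    have TS: "T \<subseteq> S" unfolding T_def using closed_under_reachable[OF closed x] by (auto dest: trancl_into_rtrancl)
    have TC: "T \<inter> C = {}" using emp by (auto simp: R_def T_def)
    obtain y where y: "y \<in> T" using set_pmf_not_empty[of "K x"] by (auto simp: T_def)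
    have "\<exists>b<\<infinity>. \<forall>x\<in>T. \<forall>n. trunc_hit_time K {} n x \<le> W x + b"
    proof (rule bounded_hit_time[OF T])
      fix z assume z: "z \<in> T"
      then have zS: "z \<in> S" using TS by auto
      have "(\<integral>\<^sup>+y. W y \<partial>measure_pmf (K z)) \<le> (\<integral>\<^sup>+y. (if y \<in> C then 0 else W y) \<partial>measure_pmf (K z))"
        by (rule nn_integral_pmf_mono) (use T z TC in \<open>auto simp: closed_under_def\<close>)
      then show "1 + (\<integral>\<^sup>+y. (if y \<in> {} then 0 else W y) \<partial>measure_pmf (K z)) \<le> W z"
        using W[OF zS] by (simp add: order_trans[OF add_left_mono])
      show "W z < \<infinity>" using zS W_fin by auto
    qed auto
    then obtain b where b: "b < \<infinity>" "\<And>n. trunc_hit_time K {} n y \<le> W y + b" using y by blast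
    have "survive K {} n z = 1" for n z by (induction n arbitrary: z) (simp_all cong: if_cong)
    then have "of_nat n \<le> W y + b" for n using b(2)[of n] by (simp add: trunc_hit_time_def)
    moreover have "W y + b < \<infinity>" using b(1) W_fin TS y by auto
    ultimately show False
      by (metis ennreal_Ex_less_of_nat infinity_ennreal_def leD)
  qed
  have reach: "\<exists>d\<in>{s. pos_recurrent_state K s}. (x, d) \<in> (step_rel K)\<^sup>+" if x: "x \<in> C" for x
  proof -
    \<comment> \<open>\<open>R\<close> shrinks along reachability, so minimal cardinality at
      \<open>y0\<close> forces every state of \<open>R y0\<close> to have the same \<open>R\<close>;
      these states all reach one another.\<close>
    obtain y0 where y0: "y0 \<in> R x" "\<And>z. z \<in> R x \<Longrightarrow> card (R y0) \<le> card (R z)"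
      using R_ne[of x] x CS ex_has_least_nat[of "\<lambda>y. y \<in> R x" _ "\<lambda>y. card (R y)"] by blast
    have min: "R z = R y0" if "z \<in> R y0" for z
      using R_mono[OF that] R_mono[OF y0(1)] y0(2)[of z] that card_seteq[OF R_fin[of y0], of "R z"] by auto
    obtain y where y: "y \<in> R y0" using R_ne[of y0] y0(1) CS by (auto simp: R_def)
    have ret: "(z, y) \<in> (step_rel K)\<^sup>+" if "z \<in> R y" for z
      using min[of z] min[OF y] that y by (auto simp: R_def)
    \<comment> \<open>Among the states reachable from \<open>y\<close>, every element of
      \<open>C\<close> leads back to \<open>y\<close>, as the hitting time bound demands.\<close>
    define T where "T = {z. (y, z) \<in> (step_rel K)\<^sup>*}"
    have TS: "T \<subseteq> S" using closed_under_reachable[OF closed, of y] y CS by (auto simp: T_def R_def)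
    have yy: "(y, y) \<in> (step_rel K)\<^sup>+" using min[OF y] y by (auto simp: R_def)
    have "\<exists>b<\<infinity>. \<forall>x\<in>T. \<forall>n. trunc_hit_time K {y} n x \<le> W x + b"
    proof (rule bounded_hit_time[where C = "C \<inter> T"])
      show T: "closed_under K T" unfolding T_def by (rule reachable_closed)
      fix z
      show "\<exists>d\<in>{y}. (z, d) \<in> (step_rel K)\<^sup>+" if "z \<in> C \<inter> T"
      proof -
        have "z = y \<or> z \<in> R y" using that by (auto simp: T_def R_def rtrancl_eq_or_trancl)
        then show ?thesis using ret[of z] yy by blast
      qed
      assume z: "z \<in> T"
      then have zS: "z \<in> S" using TS by auto
      have "(\<integral>\<^sup>+y. (if y \<in> C \<inter> T then 0 else W y) \<partial>measure_pmf (K z)) \<le> (\<integral>\<^sup>+y. (if y \<in> C then 0 else W y) \<partial>measure_pmf (K z))"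
        by (rule nn_integral_pmf_mono) (use T z in \<open>auto simp: closed_under_def\<close>)
      then show "1 + (\<integral>\<^sup>+y. (if y \<in> C \<inter> T then 0 else W y) \<partial>measure_pmf (K z)) \<le> W z"
        using W[OF zS] by (meson add_left_mono order_trans)
      show "W z < \<infinity>" using zS W_fin by auto
    qed (use fin in auto)
    then obtain b where b: "b < \<infinity>" "\<And>n. trunc_hit_time K {y} n y \<le> W y + b" by (auto simp: T_def)
    have yS: "y \<in> S" using y CS by (auto simp: R_def)
    have "pos_recurrent_state K y"
      unfolding pos_recurrent_state_def
      using finite_mean_hit_time[OF b(2)] b(1) W_fin[OF yS] by simp
    moreover have "(x, y) \<in> (step_rel K)\<^sup>+" using R_mono[OF y0(1)] y by (auto simp: R_def)
    ultimately show ?thesis by blast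
  qed
  obtain b where b: "b < \<infinity>" "\<forall>x\<in>S. \<forall>n. trunc_hit_time K {s. pos_recurrent_state K s} n x \<le> W x + b"
    using bounded_hit_time[OF closed fin CS W_fin W reach] by blast
  show ?thesis
    unfolding positive_recurrent_chain_def
  proof (intro ballI disjI2)
    fix x assume x: "x \<in> S"
    show "(\<lambda>n. first_hit K {s. pos_recurrent_state K s} n x) sums 1"
      by (rule finite_mean_hit_time(1)[where b = "W x + b"]) (use b x W_fin[OF x] in auto)
  qed
qed

text \<open>Replacing \<open>V\<close> on \<open>C\<close> by one plus its mean after one step makes
  the inequality for the return time to \<open>C\<close> hold on all of \<open>S\<close>.\<close>

theorem foster_lyapunov:
  fixes V :: "'a \<Rightarrow> ennreal"
  assumes closed: "closed_under K S" and fin: "finite C" and CS: "C \<subseteq> S"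
    and V_fin: "\<And>x. x \<in> S \<Longrightarrow> V x < \<infinity>"
    and V_C: "\<And>x. x \<in> C \<Longrightarrow> (\<integral>\<^sup>+y. V y \<partial>measure_pmf (K x)) < \<infinity>"
    and drift: "\<And>x. x \<in> S - C \<Longrightarrow> 1 + (\<integral>\<^sup>+y. V y \<partial>measure_pmf (K x)) \<le> V x"
  shows "positive_recurrent_chain K S"
proof (rule positive_recurrent_of_finite_hit_time[OF closed fin CS])
  let ?W = "\<lambda>x. if x \<in> C then 1 + (\<integral>\<^sup>+y. V y \<partial>measure_pmf (K x)) else V x"
  fix x assume x: "x \<in> S"
  show "?W x < \<infinity>" using V_fin[OF x] V_C[of x] by auto
  have "(\<integral>\<^sup>+y. (if y \<in> C then 0 else ?W y) \<partial>measure_pmf (K x)) \<le> (\<integral>\<^sup>+y. V y \<partial>measure_pmf (K x))"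
    by (rule nn_integral_pmf_mono) auto
  then have "1 + (\<integral>\<^sup>+y. (if y \<in> C then 0 else ?W y) \<partial>measure_pmf (K x)) \<le> 1 + (\<integral>\<^sup>+y. V y \<partial>measure_pmf (K x))"
    by (rule add_left_mono)
  also have "\<dots> \<le> ?W x" using drift[of x] x by auto
  finally show "1 + (\<integral>\<^sup>+y. (if y \<in> C then 0 else ?W y) \<partial>measure_pmf (K x)) \<le> ?W x" .
qed

section \<open>Expected drift along sequential compositions\<close>

text \<open>Bounded arrivals give every distribution within a slot finite support, so real
  expectations compose without integrability conditions.\<close>

lemma expectation_bind_finite:
  fixes h :: "'b \<Rightarrow> real"
  assumes "finite (set_pmf p)" "\<And>x. x \<in> set_pmf p \<Longrightarrow> finite (set_pmf (g x))"
  shows "measure_pmf.expectation (bind_pmf p g) h =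
         measure_pmf.expectation p (\<lambda>x. measure_pmf.expectation (g x) h)"
  using assms by (simp add: pmf_expectation_bind[of "set_pmf p"] integral_measure_pmf[of "set_pmf p"])

lemma expectation_mono_finite:
  fixes f g :: "'a \<Rightarrow> real"
  assumes "finite (set_pmf p)" "\<And>x. x \<in> set_pmf p \<Longrightarrow> f x \<le> g x"
  shows "measure_pmf.expectation p f \<le> measure_pmf.expectation p g"
  by (rule integral_mono_AE) (use assms in \<open>auto simp: integrable_measure_pmf_finite AE_measure_pmf_iff\<close>)

lemma expectation_add_const:
  fixes f :: "'a \<Rightarrow> real"
  assumes "finite (set_pmf p)"
  shows "measure_pmf.expectation p (\<lambda>x. f x + c) = measure_pmf.expectation p f + c"
  using assms by (subst Bochner_Integration.integral_add) (auto simp: integrable_measure_pmf_finite)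

text \<open>The invariant is indexed by the list still to be processed, so it can distinguish
  pending servers or task types from those already treated.\<close>

lemma seq_pmf_invariant:
  assumes "\<And>b bs x y. I (b # bs) x \<Longrightarrow> y \<in> set_pmf (g b x) \<Longrightarrow> I bs y"
    and "I bs x" "y \<in> set_pmf (seq_pmf g bs x)"
  shows "I [] y"
  using assms(2,3) by (induction bs arbitrary: x) (auto intro: assms(1))

lemma finite_set_pmf_seq_pmf:
  assumes "\<And>b x. b \<in> set bs \<Longrightarrow> finite (set_pmf (g b x))"
  shows "finite (set_pmf (seq_pmf g bs x))"
  using assms by (induction bs arbitrary: x) auto

text \<open>Drift bounds add up along the list because \<open>e b\<close> depends on the entry alone
  and not on the random current state.\<close>

lemma seq_pmf_drift:
  fixes \<phi> :: "'a \<Rightarrow> real"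
  assumes inv: "\<And>b bs x y. I (b # bs) x \<Longrightarrow> y \<in> set_pmf (g b x) \<Longrightarrow> I bs y"
    and drift: "\<And>b bs x. I (b # bs) x \<Longrightarrow> measure_pmf.expectation (g b x) \<phi> \<le> \<phi> x + e b"
    and fin: "\<And>b x. b \<in> set bs \<Longrightarrow> finite (set_pmf (g b x))"
    and "I bs x"
  shows "measure_pmf.expectation (seq_pmf g bs x) \<phi> \<le> \<phi> x + sum_list (map e bs)"
  using fin \<open>I bs x\<close>
proof (induction bs arbitrary: x)
  case (Cons b bs)
  have fin_b: "finite (set_pmf (g b x))" using Cons.prems by simp
  have fin_bs: "finite (set_pmf (seq_pmf g bs y))" for y
    using Cons.prems by (intro finite_set_pmf_seq_pmf) simp
  have "measure_pmf.expectation (seq_pmf g (b # bs) x) \<phi> =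
      measure_pmf.expectation (g b x) (\<lambda>y. measure_pmf.expectation (seq_pmf g bs y) \<phi>)"
    using expectation_bind_finite[OF fin_b fin_bs, where h = \<phi>] by simp
  also have "\<dots> \<le> measure_pmf.expectation (g b x) (\<lambda>y. \<phi> y + sum_list (map e bs))"
    using Cons.prems by (intro expectation_mono_finite[OF fin_b] Cons.IH) (auto intro: inv)
  also have "\<dots> = measure_pmf.expectation (g b x) \<phi> + sum_list (map e bs)"
    by (rule expectation_add_const[OF fin_b])
  also have "\<dots> \<le> \<phi> x + sum_list (map e (b # bs))"
    using drift[OF Cons.prems(2)] by simp
  finally show ?case .
qed simp

section \<open>The Lyapunov function\<close>

locale mw_rates =
  fixes M :: nat and K :: "nat \<Rightarrow> nat" and \<alpha> \<beta> \<gamma> :: real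
  assumes rates: "\<alpha> \<le> 1" "\<beta> < \<alpha>" "\<gamma> < \<beta>" "0 < \<gamma>"
begin

abbreviation r :: "nat \<Rightarrow> nat \<Rightarrow> real" where "r \<equiv> rate K \<alpha> \<beta> \<gamma>"

definition weight :: "nat \<Rightarrow> (nat \<Rightarrow> nat) \<Rightarrow> real" where
  "weight m Q = Max ((\<lambda>n. r m n * real (Q n)) ` {..<M})"

definition occ :: "(nat \<Rightarrow> int) \<Rightarrow> nat \<Rightarrow> nat" where
  "occ f n = card {m \<in> {..<M}. f m = int n}"

definition quad :: "(nat \<Rightarrow> nat) \<Rightarrow> (nat \<Rightarrow> int) \<Rightarrow> real" where
  "quad Q f = (\<Sum>n<M. (real (Q n) + real (occ f n))\<^sup>2) / 2"

text \<open>With the value 0 for idle servers, a completion removes the whole gap of the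
  server.\<close>

definition gap :: "nat \<Rightarrow> (nat \<Rightarrow> nat) \<Rightarrow> (nat \<Rightarrow> int) \<Rightarrow> real" where
  "gap m Q f = (if f m = -1 then 0 else weight m Q - r m (nat (f m)) * real (Q (nat (f m))))"

definition lyap :: "(nat \<Rightarrow> nat) \<Rightarrow> (nat \<Rightarrow> int) \<Rightarrow> real" where
  "lyap Q f = quad Q f + (\<Sum>m<M. gap m Q f) / \<gamma>"

section \<open>Bounds on rates, weights and the potential\<close>

lemma rate_bounds: "\<gamma> \<le> r m n" "0 < r m n" "r m n \<le> 1"
  using rates by (auto simp: rate_def)

lemma weight_upper: "k < M \<Longrightarrow> r m k * real (Q k) \<le> weight m Q"
  unfolding weight_def by (intro Max_ge) auto

lemma weight_least:
  assumes "m < M" "\<And>k. k < M \<Longrightarrow> r m k * real (Q k) \<le> c"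
  shows "weight m Q \<le> c"
  unfolding weight_def using assms by (subst Max_le_iff) auto

text \<open>A one-sided Lipschitz bound; the constant is 1 because no rate exceeds 1.\<close>

lemma weight_le_add:
  assumes "m < M" "\<And>n. n < M \<Longrightarrow> Q n \<le> Q' n + d"
  shows "weight m Q \<le> weight m Q' + real d"
proof (rule weight_least[OF assms(1)])
  fix k assume k: "k < M"
  have "r m k * real (Q k) \<le> r m k * (real (Q' k) + real d)"
    using assms(2)[OF k] rate_bounds(2)[of m k] by (intro mult_left_mono) (auto simp flip: of_nat_add)
  also have "\<dots> \<le> r m k * real (Q' k) + 1 * real d"
    unfolding distrib_left using rate_bounds(3)[of m k] by (intro add_left_mono mult_right_mono) auto
  finally show "r m k * real (Q k) \<le> weight m Q' + real d"
    using weight_upper[OF k, of m Q'] by simp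
qed

lemma occ_le: "occ f n \<le> M"
  unfolding occ_def using card_mono[of "{..<M}" "{m \<in> {..<M}. f m = int n}"] by auto

lemma occ_upd:
  assumes "m < M" "f m = -1"
  shows "occ (f(m := int n)) k = occ f k + (if k = n then 1 else 0)"
proof -
  have *: "{j \<in> {..<M}. (f(m := int n)) j = int k} =
      (if k = n then insert m {j \<in> {..<M}. f j = int k} else {j \<in> {..<M}. f j = int k})"
    using assms by auto
  show ?thesis
    unfolding occ_def * using assms by (auto simp: card_insert_if)
qed

lemma gap_nonneg:
  assumes "valid_state M (Q, f)" "m < M"
  shows "0 \<le> gap m Q f"
  using assms weight_upper[of _ m Q] by (auto simp: valid_state_def gap_def)

lemma lyap_nonneg: "valid_state M (Q, f) \<Longrightarrow> 0 \<le> lyap Q f"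
  unfolding lyap_def quad_def using rates gap_nonneg
  by (intro add_nonneg_nonneg divide_nonneg_pos sum_nonneg) auto

text \<open>With x = \<open>Q n + occ f n\<close>, half the difference of (x + 1)^2 and x^2 is x +
  1/2.\<close>

lemma quad_arrival:
  assumes "n < M"
  shows "quad (Q(n := Q n + 1)) f = quad Q f + real (Q n) + real (occ f n) + 1/2"
proof -
  have "(\<Sum>k\<in>{..<M} - {n}. (real ((Q(n := Q n + 1)) k) + real (occ f k))\<^sup>2) =
        (\<Sum>k\<in>{..<M} - {n}. (real (Q k) + real (occ f k))\<^sup>2)"
    by (intro sum.cong) auto
  then show ?thesis
    unfolding quad_def using assms
    by (simp add: sum.remove[of "{..<M}" n] power2_eq_square field_simps)
qed

text \<open>A completion lowers \<open>occ\<close> and not \<open>Q\<close>, since the task left its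
  queue when its service began.\<close>

lemma quad_completion:
  assumes "n < M" "m < M" "f m = int n"
  shows "quad Q (f(m := -1)) = quad Q f - real (Q n) - real (occ f n) + 1/2"
proof -
  have occ: "occ f k = occ (f(m := -1)) k + (if k = n then 1 else 0)" for k
    using occ_upd[of m "f(m := -1)" n k] assms by (simp add: fun_upd_idem)
  have "(\<Sum>k\<in>{..<M} - {n}. (real (Q k) + real (occ f k))\<^sup>2) =
        (\<Sum>k\<in>{..<M} - {n}. (real (Q k) + real (occ (f(m := -1)) k))\<^sup>2)"
    by (intro sum.cong) (auto simp: occ)
  then show ?thesis
    unfolding quad_def using assms(1)
    by (simp add: sum.remove[of "{..<M}" n] occ[of n] power2_eq_square field_simps)
qed

subsection \<open>Arrivals\<close>

lemma set_pmf_route1: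
  assumes "finite L" "L \<noteq> {}" "y \<in> set_pmf (route1 L Q)"
  shows "\<exists>n\<in>L. y = Q(n := Q n + 1) \<and> Q n = Min (Q ` L)"
proof -
  let ?A = "{n \<in> L. \<forall>n'\<in>L. Q n \<le> Q n'}"
  have min: "n \<in> ?A \<longleftrightarrow> n \<in> L \<and> Q n = Min (Q ` L)" for n
    using assms(1,2) by (auto intro!: antisym Min.boundedI)
  have "Min (Q ` L) \<in> Q ` L" using assms by (intro Min_in) auto
  then have "?A \<noteq> {}" using min by fastforce
  then have "set_pmf (pmf_of_set ?A) = ?A" using assms(1) by (intro set_pmf_of_set) auto
  then obtain n where "n \<in> ?A" "y = Q(n := Q n + 1)"
    using assms(3) unfolding route1_def by auto
  then show ?thesis using min by blast
qed

lemma finite_set_pmf_route1: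
  assumes "finite L" "L \<noteq> {}"
  shows "finite (set_pmf (route1 L Q))"
  by (rule finite_subset[of _ "(\<lambda>n. Q(n := Q n + 1)) ` L"])
     (use assms set_pmf_route1[OF assms] in auto)

text \<open>Each arrival joins a queue of current minimal length, and this minimum rises by at most
  1 per arrival. Inside the bracket \<open>real a\<close> absorbs these rises and
  \<open>real M\<close> the tasks in service.\<close>

lemma route_bound:
  assumes L: "L \<subseteq> {..<M}" "L \<noteq> {}"
    and "y \<in> set_pmf (seq_pmf route1 (replicate a L) Q)"
  shows "(\<forall>n. Q n \<le> y n \<and> y n \<le> Q n + a) \<and> (\<forall>n\<ge>M. y n = Q n) \<and>
     quad y f \<le> quad Q f + real a * (real (Min (Q ` L)) + real a + real M + 1)"
  using assms(3)
proof (induction a arbitrary: Q)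
  case (Suc a)
  have finL: "finite L" using L finite_subset by blast
  from Suc.prems obtain Q1 where Q1: "Q1 \<in> set_pmf (route1 L Q)"
    and y: "y \<in> set_pmf (seq_pmf route1 (replicate a L) Q1)" by auto
  from set_pmf_route1[OF finL L(2) Q1] obtain n
    where n: "n \<in> L" "Q1 = Q(n := Q n + 1)" "Q n = Min (Q ` L)" by blast
  note IH = Suc.IH[OF y]
  have nM: "n < M" using n L by auto
  have "Min (Q1 ` L) \<le> Q1 n" using finL n by (intro Min_le) auto
  then have min: "real (Min (Q1 ` L)) \<le> real (Min (Q ` L)) + 1" using n by simp
  have "quad y f \<le> quad Q1 f + real a * (real (Min (Q1 ` L)) + real a + real M + 1)"
    using IH by blast
  also have "\<dots> \<le> (quad Q f + real (Min (Q ` L)) + real M + 1/2)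
      + real a * (real (Min (Q ` L)) + 1 + real a + real M + 1)"
    using quad_arrival[OF nM, of Q f] n occ_le[of f n] min
    by (intro add_mono mult_left_mono) auto
  also have "\<dots> \<le> quad Q f + real (Suc a) * (real (Min (Q ` L)) + real (Suc a) + real M + 1)"
    by (simp add: algebra_simps)
  finally have "quad y f \<le> \<dots>" .
  moreover have "(\<forall>n. Q n \<le> y n \<and> y n \<le> Q n + Suc a) \<and> (\<forall>n\<ge>M. y n = Q n)"
  proof (intro conjI allI impI)
    fix k
    have k: "Q1 k \<le> y k" "y k \<le> Q1 k + a" using IH by auto
    show "Q k \<le> y k" "y k \<le> Q k + Suc a" using k n(2) by (auto split: if_splits)
    show "y k = Q k" if "M \<le> k" using IH that nM n(2) by auto
  qed
  ultimately show ?case by blast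
qed simp

lemma set_pmf_arrive_type:
  assumes "L \<subseteq> {..<M}" "L \<noteq> {}" "\<And>a. a \<in> set_pmf (arr L) \<Longrightarrow> a \<le> B"
    and "y \<in> set_pmf (arrive_type arr L Q)"
  shows "(\<forall>n. Q n \<le> y n \<and> y n \<le> Q n + B) \<and> (\<forall>n\<ge>M. y n = Q n)"
proof -
  from assms(4) obtain a where a: "a \<in> set_pmf (arr L)" and y: "y \<in> set_pmf (seq_pmf route1 (replicate a L) Q)"
    by (auto simp: arrive_type_def)
  have "y n \<le> Q n + B" for n
    using route_bound[OF assms(1,2) y] assms(3)[OF a] by (meson add_left_mono order_trans)
  then show ?thesis using route_bound[OF assms(1,2) y] by blast
qed

lemma finite_set_pmf_arrive_type:
  assumes "L \<subseteq> {..<M}" "L \<noteq> {}" "\<And>a. a \<in> set_pmf (arr L) \<Longrightarrow> a \<le> (B::nat)"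
  shows "finite (set_pmf (arrive_type arr L Q))"
proof -
  have "finite (set_pmf (arr L))" by (rule finite_subset[of _ "{..B}"]) (use assms in auto)
  moreover have "finite L" using assms(1) finite_subset by blast
  ultimately show ?thesis
    unfolding arrive_type_def set_bind_pmf using assms(2)
    by (intro finite_UN_I finite_set_pmf_seq_pmf) (auto intro: finite_set_pmf_route1)
qed

text \<open>Bounding the inner \<open>real a\<close> by \<open>B\<close> makes the increment linear
  in the number of arrivals, so its mean involves only the arrival rate.\<close>

lemma arrive_type_drift:
  assumes L: "L \<subseteq> {..<M}" "L \<noteq> {}" and B: "\<And>a. a \<in> set_pmf (arr L) \<Longrightarrow> a \<le> B"
  shows "measure_pmf.expectation (arrive_type arr L Q) (\<lambda>Q. quad Q f)
     \<le> quad Q f + measure_pmf.expectation (arr L) real * (real (Min (Q ` L)) + real B + real M + 1)"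
proof -
  have finL: "finite L" using L(1) finite_subset by blast
  have fin: "finite (set_pmf (arr L))" by (rule finite_subset[of _ "{..B}"]) (use B in auto)
  have fin_route: "finite (set_pmf (seq_pmf route1 (replicate a L) Q))" for a
    by (intro finite_set_pmf_seq_pmf) (use finL L in \<open>auto intro: finite_set_pmf_route1\<close>)
  let ?c = "real (Min (Q ` L)) + real B + real M + 1"
  have "measure_pmf.expectation (arrive_type arr L Q) (\<lambda>Q. quad Q f) =
     measure_pmf.expectation (arr L) (\<lambda>a. measure_pmf.expectation (seq_pmf route1 (replicate a L) Q) (\<lambda>Q. quad Q f))"
    unfolding arrive_type_def by (rule expectation_bind_finite[OF fin fin_route])
  also have "\<dots> \<le> measure_pmf.expectation (arr L) (\<lambda>a. real a * ?c + quad Q f)"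
  proof (rule expectation_mono_finite[OF fin])
    fix a assume a: "a \<in> set_pmf (arr L)"
    have "measure_pmf.expectation (seq_pmf route1 (replicate a L) Q) (\<lambda>Q. quad Q f)
       \<le> measure_pmf.expectation (seq_pmf route1 (replicate a L) Q) (\<lambda>_. real a * ?c + quad Q f)"
    proof (rule expectation_mono_finite[OF fin_route])
      fix y assume "y \<in> set_pmf (seq_pmf route1 (replicate a L) Q)"
      then have "quad y f \<le> quad Q f + real a * (real (Min (Q ` L)) + real a + real M + 1)"
        using route_bound[OF L] by blast
      also have "\<dots> \<le> quad Q f + real a * ?c"
        using B[OF a] by (intro add_left_mono mult_left_mono) auto
      finally show "quad y f \<le> real a * ?c + quad Q f" by simp
    qed
    then show "measure_pmf.expectation (seq_pmf route1 (replicate a L) Q) (\<lambda>Q. quad Q f) \<le> real a * ?c + quad Q f"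
      by simp
  qed
  also have "\<dots> = measure_pmf.expectation (arr L) real * ?c + quad Q f"
    by (subst expectation_add_const[OF fin]) simp
  finally show ?thesis by simp
qed

text \<open>Later types see queues lengthened by earlier arrivals. \<open>D\<close> bounds this
  growth, so each minimum can be compared with the one for the initial \<open>Q\<close>.\<close>

lemma arrivals_drift:
  fixes Q :: "nat \<Rightarrow> nat"
  assumes Ls: "\<And>L. L \<in> set Ls \<Longrightarrow> L \<subseteq> {..<M} \<and> L \<noteq> {}"
    and B: "\<And>L a. L \<in> set Ls \<Longrightarrow> a \<in> set_pmf (arr L) \<Longrightarrow> a \<le> B"
  defines "D \<equiv> B * length Ls" and "lam \<equiv> \<lambda>L. measure_pmf.expectation (arr L) real"
  shows "finite (set_pmf (seq_pmf (arrive_type arr) Ls Q))"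
    and "y \<in> set_pmf (seq_pmf (arrive_type arr) Ls Q) \<Longrightarrow>
       (\<forall>n. Q n \<le> y n \<and> y n \<le> Q n + D) \<and> (\<forall>n\<ge>M. y n = Q n)"
    and "measure_pmf.expectation (seq_pmf (arrive_type arr) Ls Q) (\<lambda>Q. quad Q f)
       \<le> quad Q f + (\<Sum>L\<leftarrow>Ls. lam L * (real (Min (Q ` L)) + real D + real B + real M + 1))"
proof -
  show fin: "finite (set_pmf (seq_pmf (arrive_type arr) Ls Q))"
    by (rule finite_set_pmf_seq_pmf, rule finite_set_pmf_arrive_type[of _ _ B]) (use Ls B in auto)
  define I where "I bs y \<longleftrightarrow> set bs \<subseteq> set Ls \<and> length bs \<le> length Ls \<and>
      (\<forall>n. Q n \<le> y n \<and> y n \<le> Q n + B * (length Ls - length bs)) \<and> (\<forall>n\<ge>M. y n = Q n)" for bs y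
  have I: "I bs y'" if "I (L # bs) y" "y' \<in> set_pmf (arrive_type arr L y)" for L bs y y'
  proof -
    have L: "L \<in> set Ls" using that(1) by (simp add: I_def)
    have *: "(\<forall>n. y n \<le> y' n \<and> y' n \<le> y n + B) \<and> (\<forall>n\<ge>M. y' n = y n)"
      by (rule set_pmf_arrive_type[OF _ _ _ that(2)]) (use Ls[OF L] B[OF L] in auto)
    have "length Ls - length bs = Suc (length Ls - length (L # bs))"
      using that(1) by (auto simp: I_def)
    then have e: "B * (length Ls - length bs) = B * (length Ls - length (L # bs)) + B" by simp
    have "Q n \<le> y' n \<and> y' n \<le> Q n + B * (length Ls - length bs)" for n
    proof -
      have "Q n \<le> y n" "y n \<le> Q n + B * (length Ls - length (L # bs))" "y n \<le> y' n" "y' n \<le> y n + B"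
        using that(1) * unfolding I_def by blast+
      then show ?thesis unfolding e by linarith
    qed
    then show ?thesis using that(1) * by (auto simp: I_def)
  qed
  have I0: "I Ls Q" by (simp add: I_def)
  show "(\<forall>n. Q n \<le> y n \<and> y n \<le> Q n + D) \<and> (\<forall>n\<ge>M. y n = Q n)"
    if "y \<in> set_pmf (seq_pmf (arrive_type arr) Ls Q)"
  proof -
    have "I [] y" by (rule seq_pmf_invariant[where I = I, OF _ I0 that]) (rule I)
    then show ?thesis by (simp add: I_def D_def)
  qed
  show "measure_pmf.expectation (seq_pmf (arrive_type arr) Ls Q) (\<lambda>Q. quad Q f)
       \<le> quad Q f + (\<Sum>L\<leftarrow>Ls. lam L * (real (Min (Q ` L)) + real D + real B + real M + 1))"
  proof (rule seq_pmf_drift[where I = I, OF I])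
    fix L bs y assume Iy: "I (L # bs) y"
    then have L: "L \<in> set Ls" by (simp add: I_def)
    have finL: "finite L" "L \<noteq> {}" using Ls[OF L] finite_subset[of L "{..<M}"] by auto
    have lam: "0 \<le> lam L" unfolding lam_def by (rule integral_nonneg_AE) simp
    have "Min (y ` L) \<le> Min (Q ` L) + D"
    proof -
      have "Min (Q ` L) \<in> Q ` L" using finL by (intro Min_in) auto
      then obtain n where n: "n \<in> L" "Min (Q ` L) = Q n" by auto
      have "Min (y ` L) \<le> y n" using finL n by (intro Min_le) auto
      also have "y n \<le> Q n + B * (length Ls - length (L # bs))" using Iy unfolding I_def by blast
      also have "\<dots> \<le> Q n + D" unfolding D_def by (intro add_left_mono mult_le_mono2) simp
      finally show ?thesis using n by simp
    qed
    then have "lam L * (real (Min (y ` L)) + real B + real M + 1) \<le>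
        lam L * (real (Min (Q ` L)) + real D + real B + real M + 1)"
      using lam by (intro mult_left_mono) (auto simp flip: of_nat_add)
    then show "measure_pmf.expectation (arrive_type arr L y) (\<lambda>Q. quad Q f) \<le>
       quad y f + lam L * (real (Min (Q ` L)) + real D + real B + real M + 1)"
      using arrive_type_drift[of L arr B y f] Ls[OF L] B[OF L] unfolding lam_def by fastforce
  next
    fix L y assume "L \<in> set Ls"
    then show "finite (set_pmf (arrive_type arr L y))"
      by (intro finite_set_pmf_arrive_type[of _ _ B]) (use Ls B in auto)
  qed (use I0 in auto)
qed

subsection \<open>Scheduling and service\<close>

text \<open>Rates are positive, so maximal weight 0 means that all queues are empty; an idle server
  stays idle only then.\<close>

lemma set_pmf_sched1:
  assumes "m < M" "z' \<in> set_pmf (sched1 M K \<alpha> \<beta> \<gamma> m (Q, f))"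
  obtains (busy) "f m \<noteq> -1" "z' = (Q, f)"
  | (idle) "f m = -1" "z' = (Q, f)" "\<And>n. n < M \<Longrightarrow> Q n = 0"
  | (start) n where "f m = -1" "n < M" "0 < Q n" "z' = (Q(n := Q n - 1), f(m := int n))"
      "\<And>k. k < M \<Longrightarrow> r m k * real (Q k) \<le> r m n * real (Q n)"
proof -
  have M: "M > 0" using assms(1) by simp
  consider "f m \<noteq> -1" | "f m = -1" "weight m Q = 0" | "f m = -1" "weight m Q \<noteq> 0" by blast
  then show thesis
  proof cases
    case 1
    then show thesis using assms(2) busy by (auto simp: sched1_def)
  next
    case 2
    have "Q n = 0" if "n < M" for n
    proof (rule ccontr)
      assume "Q n \<noteq> 0"
      then have "0 < r m n * real (Q n)" using rate_bounds(2) by simp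
      then show False using weight_upper[OF that, of m Q] 2 by simp
    qed
    then show thesis using 2 assms(2) idle by (auto simp: sched1_def weight_def)
  next
    case 3
    let ?A = "{n \<in> {..<M}. r m n * real (Q n) = weight m Q}"
    have "weight m Q \<in> (\<lambda>n. r m n * real (Q n)) ` {..<M}"
      unfolding weight_def using M by (intro Max_in) auto
    then have ne: "?A \<noteq> {}" by auto
    have "z' \<in> (\<lambda>n. (Q(n := Q n - 1), f(m := int n))) ` set_pmf (pmf_of_set ?A)"
      using assms(2) 3 by (simp add: sched1_def weight_def)
    also have "set_pmf (pmf_of_set ?A) = ?A" using ne by (intro set_pmf_of_set) auto
    finally obtain n where n: "n \<in> ?A" "z' = (Q(n := Q n - 1), f(m := int n))" by blast
    have "Q n \<noteq> 0" using n(1) 3 by (metis (mono_tags, lifting) mem_Collect_eq mult_zero_right of_nat_0)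
    then show thesis using n 3 weight_upper[of _ m Q] by (intro start[of n]) auto
  qed
qed

lemma finite_set_pmf_sched1: "m < M \<Longrightarrow> finite (set_pmf (sched1 M K \<alpha> \<beta> \<gamma> m z))"
  by (rule finite_subset[of _ "insert z ((\<lambda>n. ((fst z)(n := fst z n - 1), (snd z)(m := int n))) ` {..<M})"])
     (auto elim!: set_pmf_sched1[of m _ "fst z" "snd z", simplified])

text \<open>Queues only shrink during the scheduling pass, so a choice that was maximal when it was made
stays maximal against the initial length \<open>Q0\<close> of the chosen queue.\<close>

definition sched_inv :: "(nat \<Rightarrow> nat) \<Rightarrow> (nat \<Rightarrow> int) \<Rightarrow> nat list \<Rightarrow> state \<Rightarrow> bool" where
  "sched_inv Q0 f0 ms z \<longleftrightarrow> (case z of (Q, f) \<Rightarrow>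
     distinct ms \<and> set ms \<subseteq> {..<M} \<and> valid_state M (Q, f) \<and>
     (\<forall>m\<in>set ms. f m = f0 m) \<and> (\<forall>m. f0 m \<noteq> -1 \<longrightarrow> f m = f0 m) \<and>
     (\<forall>n. Q n \<le> Q0 n \<and> Q n + occ f n = Q0 n + occ f0 n) \<and>
     (\<forall>m<M. m \<notin> set ms \<longrightarrow> f0 m = -1 \<longrightarrow>
        (f m = -1 \<longrightarrow> (\<forall>n<M. Q n = 0)) \<and>
        (f m \<noteq> -1 \<longrightarrow> (\<forall>k<M. r m k * real (Q k) \<le> r m (nat (f m)) * real (Q0 (nat (f m)))))))"

lemma sched_inv_step:
  assumes inv: "sched_inv Q0 f0 (m # ms) z" and z': "z' \<in> set_pmf (sched1 M K \<alpha> \<beta> \<gamma> m z)"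
  shows "sched_inv Q0 f0 ms z'"
proof -
  obtain Q f where z: "z = (Q, f)" by fastforce
  from inv have I: "distinct (m # ms)" "set (m # ms) \<subseteq> {..<M}" "valid_state M (Q, f)"
     "\<And>j. j \<in> set (m # ms) \<Longrightarrow> f j = f0 j" "\<And>j. f0 j \<noteq> -1 \<Longrightarrow> f j = f0 j"
     "\<And>n. Q n \<le> Q0 n" "\<And>n. Q n + occ f n = Q0 n + occ f0 n"
     "\<And>j n. j < M \<Longrightarrow> j \<notin> set (m # ms) \<Longrightarrow> f0 j = -1 \<Longrightarrow> f j = -1 \<Longrightarrow> n < M \<Longrightarrow> Q n = 0"
     "\<And>j k. j < M \<Longrightarrow> j \<notin> set (m # ms) \<Longrightarrow> f0 j = -1 \<Longrightarrow> f j \<noteq> -1 \<Longrightarrow> k < M \<Longrightarrow>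
        r j k * real (Q k) \<le> r j (nat (f j)) * real (Q0 (nat (f j)))"
    unfolding sched_inv_def z prod.case by blast+
  have m: "m < M" "f m = f0 m" using I(2) I(4)[of m] by auto
  show ?thesis
    using m(1) z'[unfolded z]
  proof (cases rule: set_pmf_sched1)
    case busy
    \<comment> \<open>\<open>m\<close> was already busy when the pass began, so the clause on
      initially idle servers says nothing about it.\<close>
    have "Q n = 0" if "j < M" "j \<notin> set ms" "f0 j = -1" "f j = -1" "n < M" for j n
      using I(8)[of j n] that busy(1) m(2) by auto
    moreover have "r j k * real (Q k) \<le> r j (nat (f j)) * real (Q0 (nat (f j)))"
      if "j < M" "j \<notin> set ms" "f0 j = -1" "f j \<noteq> -1" "k < M" for j k
      using I(9)[of j k] that busy(1) m(2) by auto
    ultimately show ?thesis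
      unfolding sched_inv_def busy(2) prod.case
      using I(1-7) by auto
  next
    case idle
    \<comment> \<open>Every queue is empty, so the left-hand side of each maximality claim
      vanishes.\<close>
    have "0 \<le> r j i * real q" for j i q using rate_bounds(2)[of j i] by simp
    then have "\<forall>k<M. r j k * real (Q k) \<le> r j i * real q" for j i q using idle(3) by simp
    then show ?thesis
      unfolding sched_inv_def idle(2) prod.case
      using I(1-7) idle(3) by simp
  next
    case (start n)
    let ?Q = "Q(n := Q n - 1)" and ?f = "f(m := int n)"
    have Qle: "?Q k \<le> Q k" for k by simp
    have valid: "valid_state M (?Q, ?f)" using I(3) m start(2) by (auto simp: valid_state_def)
    have cons: "?Q k \<le> Q0 k \<and> ?Q k + occ ?f k = Q0 k + occ f0 k" for k
      using I(6,7)[of k] occ_upd[of m f n k] m start by auto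
    have old: "f0 j = -1" "f j = ?f j" if "j < M" "j \<notin> set ms" "f0 j = -1" "j \<noteq> m" for j
      using that by auto
    \<comment> \<open>The new choice of \<open>m\<close> is maximal by \<open>start(5)\<close>.
      Earlier choices stay maximal because the left-hand sides only shrink while the right-hand
      sides refer to the fixed \<open>Q0\<close>.\<close>
    have last: "(?f j = -1 \<longrightarrow> (\<forall>k<M. ?Q k = 0)) \<and>
        (?f j \<noteq> -1 \<longrightarrow> (\<forall>k<M. r j k * real (?Q k) \<le> r j (nat (?f j)) * real (Q0 (nat (?f j)))))"
      if j: "j < M" "j \<notin> set ms" "f0 j = -1" for j
    proof (cases "j = m")
      case True
      have "r m k * real (?Q k) \<le> r m n * real (Q0 n)" if "k < M" for k
      proof -
        have "r m k * real (?Q k) \<le> r m k * real (Q k)"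
          using Qle rate_bounds(2)[of m k] by (intro mult_left_mono) auto
        also have "\<dots> \<le> r m n * real (Q n)" by (rule start(5)[OF that])
        also have "\<dots> \<le> r m n * real (Q0 n)"
          using I(6) rate_bounds(2)[of m n] by (intro mult_left_mono) auto
        finally show ?thesis .
      qed
      then show ?thesis using True by simp
    next
      case False
      have "r j k * real (?Q k) \<le> r j (nat (f j)) * real (Q0 (nat (f j)))" if "k < M" "f j \<noteq> -1" for k
      proof -
        have "r j k * real (?Q k) \<le> r j k * real (Q k)"
          using Qle rate_bounds(2)[of j k] by (intro mult_left_mono) auto
        also have "\<dots> \<le> r j (nat (f j)) * real (Q0 (nat (f j)))"
          using I(9)[of j k] j False that by simp
        finally show ?thesis .
      qed
      then show ?thesis using False I(8)[of j] j by auto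
    qed
    have keep: "\<forall>j\<in>set ms. ?f j = f0 j" "\<forall>j. f0 j \<noteq> -1 \<longrightarrow> ?f j = f0 j"
      using I(1,4,5) m start(1) by auto
    show ?thesis
      unfolding sched_inv_def start(4) prod.case
      using I(1,2) valid keep cons last by simp
  qed
qed

text \<open>\<open>quad\<close> depends only on the sums \<open>Q n + occ f n\<close>, which the
  pass preserves. A newly started server made a maximal choice, and the chosen queue loses at most
  \<open>M\<close> tasks in the pass, so its gap is at most \<open>M\<close>.\<close>

lemma schedule_bounds:
  assumes valid: "valid_state M (Q1, f)"
    and z2: "(Q2, f2) \<in> set_pmf (seq_pmf (sched1 M K \<alpha> \<beta> \<gamma>) [0..<M] (Q1, f))"
  shows "valid_state M (Q2, f2)"
    and "\<And>n. Q2 n \<le> Q1 n" and "\<And>n. Q1 n \<le> Q2 n + M"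
    and "quad Q2 f2 = quad Q1 f"
    and "\<And>m. f m \<noteq> -1 \<Longrightarrow> f2 m = f m"
    and "\<And>m. m < M \<Longrightarrow> f2 m = -1 \<Longrightarrow> weight m Q2 \<le> 0"
    and "\<And>m. m < M \<Longrightarrow> f m = -1 \<Longrightarrow> gap m Q2 f2 \<le> real M"
proof -
  have I0: "sched_inv Q1 f [0..<M] (Q1, f)" using valid by (auto simp: sched_inv_def)
  have "sched_inv Q1 f [] (Q2, f2)"
    by (rule seq_pmf_invariant[where I = "sched_inv Q1 f", OF _ I0 z2]) (rule sched_inv_step)
  then have I: "valid_state M (Q2, f2)" "\<And>j. f j \<noteq> -1 \<Longrightarrow> f2 j = f j"
     "\<And>n. Q2 n \<le> Q1 n" "\<And>n. Q2 n + occ f2 n = Q1 n + occ f n"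
     "\<And>j n. j < M \<Longrightarrow> f j = -1 \<Longrightarrow> f2 j = -1 \<Longrightarrow> n < M \<Longrightarrow> Q2 n = 0"
     "\<And>j k. j < M \<Longrightarrow> f j = -1 \<Longrightarrow> f2 j \<noteq> -1 \<Longrightarrow> k < M \<Longrightarrow>
        r j k * real (Q2 k) \<le> r j (nat (f2 j)) * real (Q1 (nat (f2 j)))"
    by (auto simp: sched_inv_def)
  show "valid_state M (Q2, f2)" "\<And>n. Q2 n \<le> Q1 n" "\<And>m. f m \<noteq> -1 \<Longrightarrow> f2 m = f m" by (fact I)+
  show le: "Q1 n \<le> Q2 n + M" for n using I(4)[of n] occ_le[of f2 n] by linarith
  have "real (Q2 n) + real (occ f2 n) = real (Q1 n) + real (occ f n)" for n
    using I(4)[of n] by (simp flip: of_nat_add)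
  then show "quad Q2 f2 = quad Q1 f" by (simp add: quad_def)
  show "weight m Q2 \<le> 0" if "m < M" "f2 m = -1" for m
  proof (rule weight_least[OF that(1)])
    fix k assume "k < M"
    moreover have "f m = -1" using that(2) I(2)[of m] by auto
    ultimately show "r m k * real (Q2 k) \<le> 0" using I(5)[OF that(1)] that(2) by simp
  qed
  show "gap m Q2 f2 \<le> real M" if m: "m < M" "f m = -1" for m
  proof (cases "f2 m = -1")
    case False
    let ?n = "nat (f2 m)"
    have "weight m Q2 \<le> r m ?n * real (Q1 ?n)"
      using I(6)[OF m False] by (intro weight_least m(1))
    also have "\<dots> \<le> r m ?n * (real (Q2 ?n) + real M)"
      using le[of ?n] rate_bounds(2)[of m ?n] by (intro mult_left_mono) (auto simp flip: of_nat_add)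
    also have "\<dots> \<le> r m ?n * real (Q2 ?n) + 1 * real M"
      unfolding distrib_left using rate_bounds(3)[of m ?n] by (intro add_left_mono mult_right_mono) auto
    finally show ?thesis using False by (simp add: gap_def)
  qed (simp add: gap_def)
qed

lemma set_pmf_serve1: "set_pmf (serve1 K \<alpha> \<beta> \<gamma> m f) \<subseteq> {f, f(m := -1)}"
  by (auto simp: serve1_def)

text \<open>A completion lowers the potential by at least
  \<open>Q n - 1/2 + gap m Q f / \<gamma>\<close>. Its probability \<open>r m n\<close> is at least
  \<gamma>, so the mean decrease is at least \<open>r m n * Q n + gap m Q f - 1/2\<close>, and the
  first two terms sum to \<open>weight m Q\<close>.\<close>

lemma serve1_drift:
  assumes m: "m < M" and valid: "valid_state M (Q, f)" and idle: "f m = -1 \<Longrightarrow> weight m Q \<le> 0"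
  shows "measure_pmf.expectation (serve1 K \<alpha> \<beta> \<gamma> m f) (lyap Q) \<le> lyap Q f + (1/2 - weight m Q)"
proof (cases "f m = -1")
  case True
  then show ?thesis using idle by (simp add: serve1_def)
next
  case False
  then obtain n where n: "n < M" "f m = int n" using valid m by (auto simp: valid_state_def)
  have gap_m: "gap m Q f = weight m Q - r m n * real (Q n)" using False n by (simp add: gap_def)
  have "(\<Sum>k\<in>{..<M} - {m}. gap k Q (f(m := -1))) = (\<Sum>k\<in>{..<M} - {m}. gap k Q f)"
    by (intro sum.cong) (auto simp: gap_def)
  then have "(\<Sum>k<M. gap k Q (f(m := -1))) = (\<Sum>k<M. gap k Q f) - gap m Q f"
    using m by (simp add: sum.remove[of "{..<M}" m] gap_def)
  then have lyap': "lyap Q (f(m := -1)) = lyap Q f - (real (Q n) + real (occ f n) - 1/2 + gap m Q f / \<gamma>)"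
    unfolding lyap_def quad_completion[where f = f, OF n(1) m n(2)] by (simp add: diff_divide_distrib)
  have "r m n * gap m Q f \<ge> \<gamma> * gap m Q f"
    using rate_bounds(1) gap_nonneg[OF valid m] by (intro mult_right_mono) auto
  then have gap: "r m n * (gap m Q f / \<gamma>) \<ge> gap m Q f" using rates by (simp add: field_simps)
  have "measure_pmf.expectation (serve1 K \<alpha> \<beta> \<gamma> m f) (lyap Q) =
      lyap Q (f(m := -1)) * r m n + lyap Q f * (1 - r m n)"
    using False n rate_bounds[of m n] by (simp add: serve1_def)
  also have "\<dots> = lyap Q f - r m n * real (Q n) - r m n * real (occ f n) + r m n / 2 - r m n * (gap m Q f / \<gamma>)"
    unfolding lyap' by (simp add: algebra_simps)
  also have "\<dots> \<le> lyap Q f - r m n * real (Q n) + 1/2 - gap m Q f"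
  proof -
    have "0 \<le> r m n * real (occ f n)" using rate_bounds(2)[of m n] by simp
    then show ?thesis using gap rate_bounds(3)[of m n] by linarith
  qed
  finally show ?thesis using gap_m by simp
qed

lemma service_drift:
  assumes valid: "valid_state M (Q, f)" and idle: "\<And>m. m < M \<Longrightarrow> f m = -1 \<Longrightarrow> weight m Q \<le> 0"
  shows "measure_pmf.expectation (seq_pmf (serve1 K \<alpha> \<beta> \<gamma>) [0..<M] f) (lyap Q)
     \<le> lyap Q f + (\<Sum>m<M. 1/2 - weight m Q)"
    and "f3 \<in> set_pmf (seq_pmf (serve1 K \<alpha> \<beta> \<gamma>) [0..<M] f) \<Longrightarrow> valid_state M (Q, f3)"
    and "finite (set_pmf (seq_pmf (serve1 K \<alpha> \<beta> \<gamma>) [0..<M] f))"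
proof -
  \<comment> \<open>A server may become idle by a completion while queues are nonempty. The
    hypothesis on idle servers concerns the start of the pass, so pending servers are recorded as
    still having their initial status.\<close>
  define I where "I ms g \<longleftrightarrow> distinct ms \<and> set ms \<subseteq> {..<M} \<and> valid_state M (Q, g) \<and>
     (\<forall>m\<in>set ms. g m = f m)" for ms g
  have I: "I ms g'" if "I (m # ms) g" "g' \<in> set_pmf (serve1 K \<alpha> \<beta> \<gamma> m g)" for m ms g g'
  proof -
    have "g' = g \<or> g' = g(m := -1)" using that(2) set_pmf_serve1[of m g] by blast
    then show ?thesis using that(1) by (elim disjE) (auto simp: I_def valid_state_def)
  qed
  have I0: "I [0..<M] f" using valid by (auto simp: I_def)
  show "valid_state M (Q, f3)" if "f3 \<in> set_pmf (seq_pmf (serve1 K \<alpha> \<beta> \<gamma>) [0..<M] f)"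
  proof -
    have "I [] f3" by (rule seq_pmf_invariant[where I = I, OF _ I0 that]) (rule I)
    then show ?thesis by (simp add: I_def)
  qed
  have fin: "finite (set_pmf (serve1 K \<alpha> \<beta> \<gamma> m g))" for m g
    using set_pmf_serve1 by (rule finite_subset) simp
  then show "finite (set_pmf (seq_pmf (serve1 K \<alpha> \<beta> \<gamma>) [0..<M] f))"
    by (intro finite_set_pmf_seq_pmf)
  have "measure_pmf.expectation (seq_pmf (serve1 K \<alpha> \<beta> \<gamma>) [0..<M] f) (lyap Q)
     \<le> lyap Q f + (\<Sum>m\<leftarrow>[0..<M]. 1/2 - weight m Q)"
  proof (rule seq_pmf_drift[where I = I, OF I _ fin I0])
    fix m ms g assume "I (m # ms) g"
    then show "measure_pmf.expectation (serve1 K \<alpha> \<beta> \<gamma> m g) (lyap Q) \<le> lyap Q g + (1/2 - weight m Q)"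
      using idle[of m] by (intro serve1_drift) (auto simp: I_def)
  qed
  then show "measure_pmf.expectation (seq_pmf (serve1 K \<alpha> \<beta> \<gamma>) [0..<M] f) (lyap Q)
     \<le> lyap Q f + (\<Sum>m<M. 1/2 - weight m Q)"
    by (simp add: sum_list_distinct_conv_sum_set atLeast0LessThan del: sum_list_subtractf)
qed

subsection \<open>Drift over one slot\<close>

text \<open>Some queue of \<open>L\<close> offers server \<open>m\<close> at least the rate of the
  type: its own, one in its rack, or any other. The length of that queue is at least the minimum
  over \<open>L\<close>.\<close>

lemma weight_ge_type_rate:
  assumes L: "L \<subseteq> {..<M}" "L \<noteq> {}"
  shows "type_rate K \<alpha> \<beta> \<gamma> L m * real (Min (Q ` L)) \<le> weight m Q"
proof -
  have finL: "finite L" using L(1) finite_subset by blast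
  have "\<exists>n\<in>L. type_rate K \<alpha> \<beta> \<gamma> L m \<le> r m n"
  proof (cases "m \<in> L")
    case True
    then show ?thesis by (auto simp: type_rate_def rate_def intro!: bexI[of _ m])
  next
    case False
    show ?thesis
    proof (cases "\<exists>n\<in>L. K m = K n")
      case True
      then obtain n where "n \<in> L" "K m = K n" by blast
      then show ?thesis using False by (auto simp: type_rate_def rate_def intro!: bexI[of _ n])
    next
      case no_rack: False
      then show ?thesis using False L(2) rate_bounds(1)[of m] by (auto simp: type_rate_def)
    qed
  qed
  then obtain n where n: "n \<in> L" "type_rate K \<alpha> \<beta> \<gamma> L m \<le> r m n" by blast
  have "type_rate K \<alpha> \<beta> \<gamma> L m * real (Min (Q ` L)) \<le> r m n * real (Q n)"
    using n finL rate_bounds(2)[of m n] by (intro mult_mono) auto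
  also have "\<dots> \<le> weight m Q" using n L by (intro weight_upper) auto
  finally show ?thesis .
qed

text \<open>Each arrival rate is split over the servers as in the capacity region, and every minimum
  is bounded by a weight divided by the type rate. Exchanging the sums gives each weight the load
  \<open>\<rho> m\<close> as its coefficient.\<close>

lemma capacity_slack:
  assumes cap: "lam \<in> capacity_region M K Ls \<alpha> \<beta> \<gamma>"
    and Ls: "\<And>L. L \<in> set Ls \<Longrightarrow> L \<subseteq> {..<M} \<and> L \<noteq> {}"
  shows "\<exists>\<epsilon>>0. \<forall>Q. (\<Sum>L\<in>set Ls. lam L * real (Min (Q ` L))) \<le> (1 - \<epsilon>) * (\<Sum>m<M. weight m Q)"
proof -
  let ?\<tau> = "type_rate K \<alpha> \<beta> \<gamma>"
  from cap obtain l where l: "\<And>L m. 0 \<le> l L m" "\<And>L. L \<in> set Ls \<Longrightarrow> lam L = (\<Sum>m<M. l L m)"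
    "\<And>m. m < M \<Longrightarrow> (\<Sum>L\<in>set Ls. l L m / ?\<tau> L m) < 1"
    unfolding capacity_region_def by blast
  define \<rho> where "\<rho> m = (\<Sum>L\<in>set Ls. l L m / ?\<tau> L m)" for m
  have \<tau>: "0 < ?\<tau> L m" for L m using rates by (auto simp: type_rate_def)
  \<comment> \<open>The smallest spare capacity of a server; the inserted 1 keeps the set nonempty
    when \<open>M = 0\<close>.\<close>
  define \<epsilon> where "\<epsilon> = Min (insert 1 ((\<lambda>m. 1 - \<rho> m) ` {..<M}))"
  have "\<epsilon> > 0" unfolding \<epsilon>_def using l(3) by (subst Min_gr_iff) (auto simp: \<rho>_def)
  moreover have "(\<Sum>L\<in>set Ls. lam L * real (Min (Q ` L))) \<le> (1 - \<epsilon>) * (\<Sum>m<M. weight m Q)" for Q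
  proof -
    have "(\<Sum>L\<in>set Ls. lam L * real (Min (Q ` L))) = (\<Sum>L\<in>set Ls. \<Sum>m<M. l L m * real (Min (Q ` L)))"
      using l(2) by (intro sum.cong) (auto simp: sum_distrib_right)
    also have "\<dots> \<le> (\<Sum>L\<in>set Ls. \<Sum>m<M. l L m / ?\<tau> L m * weight m Q)"
    proof (intro sum_mono)
      fix L m assume L: "L \<in> set Ls"
      have "l L m * real (Min (Q ` L)) = l L m / ?\<tau> L m * (?\<tau> L m * real (Min (Q ` L)))"
        using \<tau>[of L m] by simp
      also have "\<dots> \<le> l L m / ?\<tau> L m * weight m Q"
        using Ls[OF L] l(1) \<tau>[of L m] by (intro mult_left_mono weight_ge_type_rate) auto
      finally show "l L m * real (Min (Q ` L)) \<le> l L m / ?\<tau> L m * weight m Q" .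
    qed
    also have "\<dots> = (\<Sum>m<M. \<rho> m * weight m Q)"
      unfolding \<rho>_def sum_distrib_right by (rule sum.swap)
    also have "\<dots> \<le> (\<Sum>m<M. (1 - \<epsilon>) * weight m Q)"
    proof (intro sum_mono mult_right_mono)
      fix m assume m: "m \<in> {..<M}"
      then have "\<epsilon> \<le> 1 - \<rho> m" unfolding \<epsilon>_def by (intro Min_le) auto
      then show "\<rho> m \<le> 1 - \<epsilon>" by simp
      have "0 \<le> r m m * real (Q m)" using rate_bounds(2)[of m m] by simp
      then show "0 \<le> weight m Q" using weight_upper[of m m Q] m by simp
    qed
    finally show ?thesis by (simp add: sum_distrib_left)
  qed
  ultimately show ?thesis by blast
qed

text \<open>Arrivals contribute the minima, scheduling leaves \<open>quad\<close> unchanged, and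
  service removes the weights. During a slot a queue grows by at most \<open>D\<close> and shrinks
  by at most \<open>M\<close>, so evaluating weights and gaps at different moments costs only
  constants.\<close>

lemma step_drift:
  assumes Ls: "distinct Ls" "\<And>L. L \<in> set Ls \<Longrightarrow> L \<subseteq> {..<M} \<and> L \<noteq> {}"
    and B: "\<And>L a. L \<in> set Ls \<Longrightarrow> a \<in> set_pmf (arr L) \<Longrightarrow> a \<le> B"
  defines "step \<equiv> jsq_mw_step M K Ls arr \<alpha> \<beta> \<gamma>"
    and "lam \<equiv> \<lambda>L. measure_pmf.expectation (arr L) real"
  shows "\<exists>c. \<forall>Q f. valid_state M (Q, f) \<longrightarrow>
      finite (set_pmf (step (Q, f))) \<and> set_pmf (step (Q, f)) \<subseteq> {z. valid_state M z} \<and>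
      measure_pmf.expectation (step (Q, f)) (\<lambda>z. lyap (fst z) (snd z)) \<le>
        lyap Q f + (\<Sum>L\<in>set Ls. lam L * real (Min (Q ` L))) - (\<Sum>m<M. weight m Q) + c"
proof -
  define D where "D = B * length Ls"
  \<comment> \<open>The terms are the growth of the gaps divided by \<gamma>, the 1/2 per server
    from \<open>service_drift\<close>, and \<open>M\<close> per server for returning from the
    weights after scheduling to those at \<open>Q\<close>.\<close>
  define c where "c = real M * real (D + M) / \<gamma> + real M / 2 + real M * real M"
  define c' where "c' = (\<Sum>L\<in>set Ls. lam L * (real D + real B + real M + 1)) + c"
  have "finite (set_pmf (step (Q, f))) \<and> set_pmf (step (Q, f)) \<subseteq> {z. valid_state M z} \<and>
      measure_pmf.expectation (step (Q, f)) (\<lambda>z. lyap (fst z) (snd z)) \<le>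
        lyap Q f + (\<Sum>L\<in>set Ls. lam L * real (Min (Q ` L))) - (\<Sum>m<M. weight m Q) + c'"
    if valid: "valid_state M (Q, f)" for Q f
  proof -
    let ?A = "seq_pmf (arrive_type arr) Ls Q"
    let ?S = "\<lambda>Q1. seq_pmf (sched1 M K \<alpha> \<beta> \<gamma>) [0..<M] (Q1, f)"
    let ?R = "\<lambda>z2. seq_pmf (serve1 K \<alpha> \<beta> \<gamma>) [0..<M] (snd z2)"
    let ?h = "\<lambda>z. lyap (fst z) (snd z)"
    let ?r = "(\<Sum>m<M. gap m Q f) / \<gamma> - (\<Sum>m<M. weight m Q) + c"
    have step: "step (Q, f) = bind_pmf ?A (\<lambda>Q1. bind_pmf (?S Q1) (\<lambda>z2.
        bind_pmf (?R z2) (\<lambda>f3. return_pmf (fst z2, f3))))"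
      by (simp add: step_def jsq_mw_step_def)
    have fin_A: "finite (set_pmf ?A)"
      by (rule arrivals_drift(1)[where B = B]) (use Ls(2) B in blast)+
    have set_A: "(\<forall>n. Q n \<le> Q1 n \<and> Q1 n \<le> Q n + D) \<and> (\<forall>n\<ge>M. Q1 n = Q n)" if "Q1 \<in> set_pmf ?A" for Q1
      unfolding D_def by (rule arrivals_drift(2)[where B = B, OF _ _ that]) (use Ls(2) B in blast)+
    have drift_A: "measure_pmf.expectation ?A (\<lambda>Q. quad Q f)
       \<le> quad Q f + (\<Sum>L\<leftarrow>Ls. lam L * (real (Min (Q ` L)) + real D + real B + real M + 1))"
      unfolding D_def lam_def by (rule arrivals_drift(3)[where B = B]) (use Ls(2) B in blast)+
    have finS: "finite (set_pmf (?S Q1))" for Q1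
      by (intro finite_set_pmf_seq_pmf finite_set_pmf_sched1) auto
    have valid1: "valid_state M (Q1, f)" if "Q1 \<in> set_pmf ?A" for Q1
      using set_A[OF that] valid by (auto simp: valid_state_def)
    have valid2: "valid_state M z2" if "Q1 \<in> set_pmf ?A" "z2 \<in> set_pmf (?S Q1)" for Q1 z2
      using schedule_bounds(1)[OF valid1[OF that(1)], of "fst z2" "snd z2"] that(2) by simp
    have idle2: "weight m (fst z2) \<le> 0" if "Q1 \<in> set_pmf ?A" "z2 \<in> set_pmf (?S Q1)" "m < M" "snd z2 m = -1" for Q1 z2 m
      using schedule_bounds(6)[OF valid1[OF that(1)], of "fst z2" "snd z2"] that(2-) by simp
    have finR: "finite (set_pmf (?R z2))" and valid3: "f3 \<in> set_pmf (?R z2) \<Longrightarrow> valid_state M (fst z2, f3)"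
      if "Q1 \<in> set_pmf ?A" "z2 \<in> set_pmf (?S Q1)" for Q1 z2 f3
      using service_drift(2,3)[of "fst z2" "snd z2"] valid2[OF that] idle2[OF that] by auto
    have fin: "finite (set_pmf (step (Q, f)))"
      unfolding step set_bind_pmf set_return_pmf using fin_A finS finR by (intro finite_UN_I) auto
    have valid': "set_pmf (step (Q, f)) \<subseteq> {z. valid_state M z}"
      unfolding step set_bind_pmf set_return_pmf using valid3 by blast
    have after_arrival: "measure_pmf.expectation (?R z2) (lyap (fst z2)) \<le> quad Q1 f + ?r"
      if Q1: "Q1 \<in> set_pmf ?A" and z2: "z2 \<in> set_pmf (?S Q1)" for Q1 z2
    proof -
      obtain Q2 f2 where z2_eq: "z2 = (Q2, f2)" by fastforce
      note sb = schedule_bounds[OF valid1[OF Q1] z2[unfolded z2_eq]]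
      have Q12: "Q n \<le> Q1 n" "Q1 n \<le> Q n + D" for n using set_A[OF Q1] by auto
      have Q2: "Q n \<le> Q2 n + M" "Q2 n \<le> Q n + D" for n
        using Q12[of n] sb(2,3)[of n] by linarith+
      have weight: "weight m Q - real M \<le> weight m Q2" "weight m Q2 \<le> weight m Q + real D" if "m < M" for m
        using weight_le_add[OF that, of Q Q2 M] weight_le_add[OF that, of Q2 Q D] Q2 by auto
      \<comment> \<open>An initially idle server has gap at most \<open>M\<close> after scheduling.
        A busy one keeps its queue, whose length drops by at most \<open>M\<close>, while the
        maximal weight rises by at most \<open>D\<close>.\<close>
      have gap: "gap m Q2 f2 \<le> gap m Q f + real (D + M)" if m: "m < M" for m
      proof (cases "f m = -1")
        case True
        then show ?thesis using sb(7)[OF m True] gap_nonneg[OF valid m] by simp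
      next
        case False
        let ?n = "nat (f m)"
        have "r m ?n * real (Q ?n) \<le> r m ?n * (real (Q2 ?n) + real M)"
          using Q2(1)[of ?n] rate_bounds(2)[of m ?n] by (intro mult_left_mono) (auto simp flip: of_nat_add)
        also have "\<dots> \<le> r m ?n * real (Q2 ?n) + 1 * real M"
          unfolding distrib_left using rate_bounds(3)[of m ?n] by (intro add_left_mono mult_right_mono) auto
        finally show ?thesis
          using False sb(5)[OF False] weight(2)[OF m] by (simp add: gap_def)
      qed
      have gap_sum: "(\<Sum>m<M. gap m Q2 f2) \<le> (\<Sum>m<M. gap m Q f + real (D + M))"
        by (intro sum_mono gap) simp
      have weight_sum: "(\<Sum>m<M. 1/2 - weight m Q2) \<le> (\<Sum>m<M. 1/2 - (weight m Q - real M))"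
        by (intro sum_mono diff_left_mono weight(1)) simp
      have "measure_pmf.expectation (?R z2) (lyap (fst z2)) \<le> lyap Q2 f2 + (\<Sum>m<M. 1/2 - weight m Q2)"
        using service_drift(1)[OF sb(1) sb(6)] by (simp add: z2_eq)
      also have "\<dots> = quad Q1 f + (\<Sum>m<M. gap m Q2 f2) / \<gamma> + (\<Sum>m<M. 1/2 - weight m Q2)"
        by (simp add: lyap_def sb(4))
      also have "\<dots> \<le> quad Q1 f + (\<Sum>m<M. gap m Q f + real (D + M)) / \<gamma> + (\<Sum>m<M. 1/2 - (weight m Q - real M))"
        using rates by (intro add_mono divide_right_mono gap_sum weight_sum order_refl) simp
      also have "\<dots> = quad Q1 f + ?r"
        by (simp add: c_def sum.distrib sum_subtractf add_divide_distrib)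
      finally show ?thesis .
    qed
    have "measure_pmf.expectation (step (Q, f)) ?h =
       measure_pmf.expectation ?A (\<lambda>Q1. measure_pmf.expectation (bind_pmf (?S Q1) (\<lambda>z2.
         bind_pmf (?R z2) (\<lambda>f3. return_pmf (fst z2, f3)))) ?h)"
      unfolding step using fin_A finS finR by (intro expectation_bind_finite) auto
    also have "\<dots> \<le> measure_pmf.expectation ?A (\<lambda>Q1. quad Q1 f + ?r)"
    proof (rule expectation_mono_finite[OF fin_A])
      fix Q1 assume Q1: "Q1 \<in> set_pmf ?A"
      have "measure_pmf.expectation (bind_pmf (?S Q1) (\<lambda>z2. bind_pmf (?R z2) (\<lambda>f3. return_pmf (fst z2, f3)))) ?h =
         measure_pmf.expectation (?S Q1) (\<lambda>z2. measure_pmf.expectation (bind_pmf (?R z2) (\<lambda>f3. return_pmf (fst z2, f3))) ?h)"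
        using finS finR[OF Q1] by (intro expectation_bind_finite) auto
      also have "\<dots> \<le> measure_pmf.expectation (?S Q1) (\<lambda>_. quad Q1 f + ?r)"
      proof (rule expectation_mono_finite[OF finS])
        fix z2 assume z2: "z2 \<in> set_pmf (?S Q1)"
        have "measure_pmf.expectation (bind_pmf (?R z2) (\<lambda>f3. return_pmf (fst z2, f3))) ?h =
          measure_pmf.expectation (?R z2) (lyap (fst z2))"
          using finR[OF Q1 z2] by (subst expectation_bind_finite) auto
        then show "measure_pmf.expectation (bind_pmf (?R z2) (\<lambda>f3. return_pmf (fst z2, f3))) ?h \<le> quad Q1 f + ?r"
          using after_arrival[OF Q1 z2] by simp
      qed
      finally show "measure_pmf.expectation (bind_pmf (?S Q1) (\<lambda>z2. bind_pmf (?R z2) (\<lambda>f3. return_pmf (fst z2, f3)))) ?h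
          \<le> quad Q1 f + ?r" by simp
    qed
    also have "\<dots> = measure_pmf.expectation ?A (\<lambda>Q1. quad Q1 f) + ?r"
      by (rule expectation_add_const[OF fin_A])
    also have "\<dots> \<le> (quad Q f + (\<Sum>L\<leftarrow>Ls. lam L * (real (Min (Q ` L)) + real D + real B + real M + 1))) + ?r"
      using drift_A by (rule add_right_mono)
    also have "(\<Sum>L\<leftarrow>Ls. lam L * (real (Min (Q ` L)) + real D + real B + real M + 1)) =
        (\<Sum>L\<in>set Ls. lam L * real (Min (Q ` L)) + lam L * (real D + real B + real M + 1))"
      unfolding sum_list_distinct_conv_sum_set[OF Ls(1)] by (intro sum.cong) (auto simp: algebra_simps)
    also have "quad Q f + \<dots> + ?r =
        lyap Q f + (\<Sum>L\<in>set Ls. lam L * real (Min (Q ` L))) - (\<Sum>m<M. weight m Q) + c'"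
      by (simp add: lyap_def c'_def sum.distrib)
    finally show ?thesis using fin valid' by blast
  qed
  then show ?thesis by blast
qed

text \<open>\<open>valid_state\<close> fixes all coordinates from \<open>M\<close> on and leaves
  finitely many values of the working status, so only the queue lengths need a bound.\<close>

lemma finite_bounded_states: "finite {z. valid_state M z \<and> (\<Sum>m<M. real (fst z m)) \<le> b}"
proof (rule finite_subset)
  let ?F = "{Q. \<forall>m. (m \<in> {..<M} \<longrightarrow> Q m \<in> {..nat \<lfloor>b\<rfloor>}) \<and> (m \<notin> {..<M} \<longrightarrow> Q m = 0)}"
  let ?G = "{f. \<forall>m. (m \<in> {..<M} \<longrightarrow> f m \<in> insert (-1) (int ` {..<M})) \<and> (m \<notin> {..<M} \<longrightarrow> f m = -1)}"
  show "finite (?F \<times> ?G)" by (intro finite_cartesian_product finite_set_of_finite_funs) auto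
  show "{z. valid_state M z \<and> (\<Sum>m<M. real (fst z m)) \<le> b} \<subseteq> ?F \<times> ?G"
  proof
    fix z assume "z \<in> {z. valid_state M z \<and> (\<Sum>m<M. real (fst z m)) \<le> b}"
    moreover obtain Q f where z_eq: "z = (Q, f)" by fastforce
    ultimately have z: "valid_state M (Q, f)" "(\<Sum>m<M. real (Q m)) \<le> b" by auto
    have "Q m \<le> nat \<lfloor>b\<rfloor>" if "m < M" for m
      using member_le_sum[of m "{..<M}" "\<lambda>m. real (Q m)"] that z(2) by (simp add: le_nat_floor)
    then show "z \<in> ?F \<times> ?G" using z(1) by (auto simp: z_eq valid_state_def)
  qed
qed

end

section \<open>Positive recurrence throughout the capacity region from the drift bound\<close>

theorem theorem3p1:
  fixes M :: nat and K :: "nat \<Rightarrow> nat" and Ls :: "nat set list"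
    and arr :: "nat set \<Rightarrow> nat pmf" and \<alpha> \<beta> \<gamma> :: real
  assumes "distinct Ls"
    and "\<forall>L\<in>set Ls. L \<subseteq> {..<M} \<and> card L = 3"
    and "\<alpha> \<le> 1" and "\<beta> < \<alpha>" and "\<gamma> < \<beta>" and "0 < \<gamma>"
    and "\<exists>B. \<forall>A. (\<forall>L\<in>set Ls. A L \<in> set_pmf (arr L)) \<longrightarrow> (\<Sum>L\<in>set Ls. A L) \<le> B"
    and "(\<lambda>L. measure_pmf.expectation (arr L) real) \<in> capacity_region M K Ls \<alpha> \<beta> \<gamma>"
  shows "positive_recurrent_chain (jsq_mw_step M K Ls arr \<alpha> \<beta> \<gamma>) {z. valid_state M z}"
proof -
  interpret mw_rates M K \<alpha> \<beta> \<gamma> using assms(3-6) by unfold_locales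
  let ?step = "jsq_mw_step M K Ls arr \<alpha> \<beta> \<gamma>"
  let ?lam = "\<lambda>L. measure_pmf.expectation (arr L) real"
  have Ls: "L \<subseteq> {..<M} \<and> L \<noteq> {}" if "L \<in> set Ls" for L using assms(2) that by fastforce
  obtain B where B: "\<And>A. (\<And>L. L \<in> set Ls \<Longrightarrow> A L \<in> set_pmf (arr L)) \<Longrightarrow> (\<Sum>L\<in>set Ls. A L) \<le> B"
    using assms(7) by blast
  \<comment> \<open>The bound \<open>B\<close> is on totals; one type is isolated by giving the
    others arbitrary values from their supports.\<close>
  have arr_B: "a \<le> B" if L: "L \<in> set Ls" and a: "a \<in> set_pmf (arr L)" for L a
  proof -
    define A where "A L' = (if L' = L then a else (SOME x. x \<in> set_pmf (arr L')))" for L'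
    have "A L' \<in> set_pmf (arr L')" for L'
      using a set_pmf_not_empty[of "arr L'"] by (auto simp: A_def some_in_eq)
    then have "(\<Sum>L\<in>set Ls. A L) \<le> B" by (rule B)
    moreover have "A L \<le> (\<Sum>L\<in>set Ls. A L)" using L by (intro member_le_sum) auto
    ultimately show ?thesis by (simp add: A_def)
  qed
  obtain \<epsilon> where \<epsilon>: "\<epsilon> > 0"
    "\<And>Q. (\<Sum>L\<in>set Ls. ?lam L * real (Min (Q ` L))) \<le> (1 - \<epsilon>) * (\<Sum>m<M. weight m Q)"
    using capacity_slack[OF assms(8) Ls] by blast
  have "\<exists>c. \<forall>Q f. valid_state M (Q, f) \<longrightarrow>
      finite (set_pmf (?step (Q, f))) \<and> set_pmf (?step (Q, f)) \<subseteq> {z. valid_state M z} \<and>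
      measure_pmf.expectation (?step (Q, f)) (\<lambda>z. lyap (fst z) (snd z)) \<le>
        lyap Q f + (\<Sum>L\<in>set Ls. ?lam L * real (Min (Q ` L))) - (\<Sum>m<M. weight m Q) + c"
    by (rule step_drift[where B = B]) (use assms(1) Ls arr_B in blast)+
  then obtain c where c: "\<And>Q f. valid_state M (Q, f) \<Longrightarrow>
      finite (set_pmf (?step (Q, f))) \<and> set_pmf (?step (Q, f)) \<subseteq> {z. valid_state M z} \<and>
      measure_pmf.expectation (?step (Q, f)) (\<lambda>z. lyap (fst z) (snd z)) \<le>
        lyap Q f + (\<Sum>L\<in>set Ls. ?lam L * real (Min (Q ` L))) - (\<Sum>m<M. weight m Q) + c"
    by blast
  have drift: "measure_pmf.expectation (?step (Q, f)) (\<lambda>z. lyap (fst z) (snd z)) \<le>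
        lyap Q f - \<epsilon> * \<alpha> * (\<Sum>m<M. real (Q m)) + c" if "valid_state M (Q, f)" for Q f
  proof -
    \<comment> \<open>Each server could serve its own queue, at rate \<alpha>.\<close>
    have "\<alpha> * (\<Sum>m<M. real (Q m)) \<le> (\<Sum>m<M. weight m Q)"
      unfolding sum_distrib_left using weight_upper[of _ _ Q]
      by (intro sum_mono) (metis lessThan_iff rate_def)
    then have "\<epsilon> * (\<alpha> * (\<Sum>m<M. real (Q m))) \<le> \<epsilon> * (\<Sum>m<M. weight m Q)"
      using \<epsilon>(1) by (intro mult_left_mono) auto
    then show ?thesis using c[OF that] \<epsilon>(2)[of Q] by (simp add: algebra_simps)
  qed
  let ?V = "\<lambda>z. ennreal (lyap (fst z) (snd z))"
  have V: "(\<integral>\<^sup>+z. ?V z \<partial>measure_pmf (?step (Q, f))) =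
      ennreal (measure_pmf.expectation (?step (Q, f)) (\<lambda>z. lyap (fst z) (snd z)))"
    if "valid_state M (Q, f)" for Q f
    by (rule nn_integral_eq_integral)
       (use c[OF that] lyap_nonneg in \<open>auto simp: integrable_measure_pmf_finite AE_measure_pmf_iff\<close>)
  \<comment> \<open>The threshold \<open>(c + 1) / (\<epsilon> * \<alpha>)\<close> is the total
    queue length at which the drift bound reaches -1.\<close>
  show ?thesis
  proof (rule foster_lyapunov[where V = ?V and
        C = "{z. valid_state M z \<and> (\<Sum>m<M. real (fst z m)) \<le> (c + 1) / (\<epsilon> * \<alpha>)}"])
    show "closed_under ?step {z. valid_state M z}"
      unfolding closed_under_def using c by auto
    show "finite {z. valid_state M z \<and> (\<Sum>m<M. real (fst z m)) \<le> (c + 1) / (\<epsilon> * \<alpha>)}"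
      by (rule finite_bounded_states)
    fix z :: state
    obtain Q f where z: "z = (Q, f)" by fastforce
    show "(\<integral>\<^sup>+y. ?V y \<partial>measure_pmf (?step z)) < \<infinity>"
      if "z \<in> {z. valid_state M z \<and> (\<Sum>m<M. real (fst z m)) \<le> (c + 1) / (\<epsilon> * \<alpha>)}"
      using V[of Q f] that z by simp
    assume "z \<in> {z. valid_state M z} - {z. valid_state M z \<and> (\<Sum>m<M. real (fst z m)) \<le> (c + 1) / (\<epsilon> * \<alpha>)}"
    then have valid: "valid_state M (Q, f)" and large: "(c + 1) / (\<epsilon> * \<alpha>) < (\<Sum>m<M. real (Q m))"
      using z by auto
    have "0 < \<epsilon> * \<alpha>" using \<epsilon>(1) assms(4-6) by simp
    then have "c + 1 \<le> \<epsilon> * \<alpha> * (\<Sum>m<M. real (Q m))" using large by (simp add: field_simps)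
    then have le: "1 + measure_pmf.expectation (?step (Q, f)) (\<lambda>z. lyap (fst z) (snd z)) \<le> lyap Q f"
      using drift[OF valid] by linarith
    have "0 \<le> measure_pmf.expectation (?step (Q, f)) (\<lambda>z. lyap (fst z) (snd z))"
      by (rule integral_nonneg_AE) (use c[OF valid] lyap_nonneg in \<open>auto simp: AE_measure_pmf_iff\<close>)
    then have "1 + (\<integral>\<^sup>+y. ?V y \<partial>measure_pmf (?step (Q, f))) =
        ennreal (1 + measure_pmf.expectation (?step (Q, f)) (\<lambda>z. lyap (fst z) (snd z)))"
      unfolding V[OF valid] by (simp add: ennreal_plus)
    then show "1 + (\<integral>\<^sup>+y. ?V y \<partial>measure_pmf (?step z)) \<le> ?V z"
      using le by (simp add: z ennreal_leI)
  qed auto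
qed

end
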